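(* If $K$ is an infinite compact metrizable $C$-space and $L$ is an arbitrary compact space, then $C_p(K)$ and $C_w(L)$ are not homeomorphic.
   Context: All topological spaces are assumed to be Tychonoff, so compact spaces are compact Hausdorff. For a compact space $K$, $C(K)$ denotes the Banach space of all real-valued continuous functions on $K$ with the supremum norm. $C_w(K)$ denotes the set $C(K)$ equipped with the weak topology of this Banach space (the weakest topology making all norm-continuous linear functionals on $C(K)$ continuous). $C_p(K)$ denotes the set $C(K)$ equipped with the pointwise topology, i.e. the topology inherited from the product space $\mathbb{R}^K$. A space $X$ is a $C$-space (has property C) if for every sequence $(\mathcal{U}_n)_{n\in\mathbb{N}}$ of open covers of $X$ there is a sequence $(\mathcal{V}_n)_{n\in\mathbb{N}}$ such that each $\mathcal{V}_n$ is a family of pairwise disjoint open subsets of $X$, each member of $\mathcal{V}_n$ is contained in some member of $\mathcal{U}_n$, and $\bigcup_{n}\mathcal{V}_n$ covers $X$. *)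

theory Defs
  imports "HOL-Analysis.Analysis"
begin

text \<open>
  Spaces are abstract topologies, so that compact spaces range over arbitrary carriers, the empty
  one included. A function on the space \<open>K\<close> is a HOL function that is \<^const>\<open>extensional\<close> on
  \<^term>\<open>topspace K\<close>, the convention of \<^const>\<open>product_topology\<close> and \<^const>\<open>cfunspace\<close>. Pointwise
  sums and multiples must therefore be restricted to \<^term>\<open>topspace K\<close>.
\<close>

definition contfuns :: "'a topology \<Rightarrow> ('a \<Rightarrow> real) set" where
  "contfuns K = {f \<in> extensional (topspace K). continuous_map K euclideanreal f}"

text \<open>
  \<^term>\<open>cfunspace K euclidean_metric\<close> is the metric space of bounded continuous real functions with
  the supremum distance. Boundedness is automatic for compact \<open>K\<close>.
\<close>

definition sup_norm_topology :: "'a topology \<Rightarrow> ('a \<Rightarrow> real) topology" where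
  "sup_norm_topology K = mtopology_of (cfunspace K euclidean_metric)"

lemma mspace_cfunspace_compact:
  assumes "compact_space K"
  shows "mspace (cfunspace K euclidean_metric) = contfuns K"
proof -
  have "compactin K (topspace K)"
    using assms by (simp add: compact_space_def)
  from compactin_mspace_cfunspace[OF this, of euclidean_metric] show ?thesis
    by (auto simp: contfuns_def simp del: mspace_cfunspace)
qed

lemma topspace_sup_norm_topology:
  "compact_space K \<Longrightarrow> topspace (sup_norm_topology K) = contfuns K"
  by (simp add: sup_norm_topology_def mspace_cfunspace_compact del: mspace_cfunspace)

definition linear_functional_on_C :: "'a topology \<Rightarrow> (('a \<Rightarrow> real) \<Rightarrow> real) \<Rightarrow> bool" where
  "linear_functional_on_C K \<phi> \<longleftrightarrow>
     (\<forall>f \<in> contfuns K. \<forall>g \<in> contfuns K.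
        \<phi> (restrict (\<lambda>x. f x + g x) (topspace K)) = \<phi> f + \<phi> g) \<and>
     (\<forall>c. \<forall>f \<in> contfuns K. \<phi> (restrict (\<lambda>x. c * f x) (topspace K)) = c * \<phi> f)"

definition dual_C :: "'a topology \<Rightarrow> (('a \<Rightarrow> real) \<Rightarrow> real) set" where
  "dual_C K = {\<phi>. linear_functional_on_C K \<phi> \<and>
                  continuous_map (sup_norm_topology K) euclideanreal \<phi>}"

definition C_p :: "'a topology \<Rightarrow> ('a \<Rightarrow> real) topology" where
  "C_p K = subtopology (powertop_real (topspace K)) (contfuns K)"

definition C_w :: "'a topology \<Rightarrow> ('a \<Rightarrow> real) topology" where
  "C_w K = topology_generated_by
             {{f \<in> contfuns K. \<phi> f \<in> U} | \<phi> U. \<phi> \<in> dual_C K \<and> open U}"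

lemma topspace_C_p [simp]: "topspace (C_p K) = contfuns K"
  by (auto simp: C_p_def contfuns_def PiE_def)

lemma topspace_C_w [simp]: "topspace (C_w K) = contfuns K"
proof -
  have "(\<lambda>f. 0) \<in> dual_C K"
    by (simp add: dual_C_def linear_functional_on_C_def)
  then have "contfuns K \<in> {{f \<in> contfuns K. \<phi> f \<in> U} | \<phi> U. \<phi> \<in> dual_C K \<and> open U}"
    by (auto intro!: exI[of _ "\<lambda>f. 0"] exI[of _ UNIV])
  then show ?thesis
    unfolding C_w_def topology_generated_by_topspace by blast
qed

lemma continuous_map_C_w_dual:
  assumes "\<phi> \<in> dual_C K"
  shows "continuous_map (C_w K) euclideanreal \<phi>"
  unfolding continuous_map_def
proof (intro conjI allI impI)
  fix U :: "real set"
  assume "openin euclideanreal U"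
  with assms show "openin (C_w K) {f \<in> topspace (C_w K). \<phi> f \<in> U}"
    unfolding topspace_C_w by (auto simp: C_w_def intro!: topology_generated_by_Basis)
qed auto

lemma C_w_weakest:
  assumes T: "topspace T = contfuns K"
    and cont: "\<And>\<phi>. \<phi> \<in> dual_C K \<Longrightarrow> continuous_map T euclideanreal \<phi>"
    and "openin (C_w K) S"
  shows "openin T S"
proof -
  have "continuous_map T (C_w K) id"
    unfolding C_w_def
  proof (rule continuous_on_generated_topo)
    show "id ` topspace T \<subseteq> \<Union> {{f \<in> contfuns K. \<phi> f \<in> U} | \<phi> U. \<phi> \<in> dual_C K \<and> open U}"
      using topspace_C_w[of K] by (simp add: C_w_def T)
  next
    fix V
    assume "V \<in> {{f \<in> contfuns K. \<phi> f \<in> U} | \<phi> U. \<phi> \<in> dual_C K \<and> open U}"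
    then obtain \<phi> U where V: "V = {f \<in> contfuns K. \<phi> f \<in> U}" "\<phi> \<in> dual_C K" "open U"
      by blast
    then have "openin T {f \<in> topspace T. \<phi> f \<in> U}"
      using cont openin_continuous_map_preimage by (metis open_openin)
    moreover have "id -` V \<inter> topspace T = {f \<in> topspace T. \<phi> f \<in> U}"
      using V T by auto
    ultimately show "openin T (id -` V \<inter> topspace T)"
      by simp
  qed
  then have "openin T {x \<in> topspace T. id x \<in> S}"
    using assms(3) openin_continuous_map_preimage by blast
  moreover have "S \<subseteq> topspace T"
    using openin_subset[OF assms(3)] T by simp
  ultimately show ?thesis
    by (simp add: Collect_conj_eq Int_absorb1)
qed

definition open_cover :: "'a topology \<Rightarrow> 'a set set \<Rightarrow> bool" where
  "open_cover X \<U> \<longleftrightarrow> (\<forall>U \<in> \<U>. openin X U) \<and> \<Union>\<U> = topspace X"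

definition C_space :: "'a topology \<Rightarrow> bool" where
  "C_space X \<longleftrightarrow>
     (\<forall>\<U> :: nat \<Rightarrow> 'a set set. (\<forall>n. open_cover X (\<U> n)) \<longrightarrow>
       (\<exists>\<V> :: nat \<Rightarrow> 'a set set.
          (\<forall>n. pairwise disjnt (\<V> n) \<and> (\<forall>V \<in> \<V> n. openin X V) \<and>
               (\<forall>V \<in> \<V> n. \<exists>U \<in> \<U> n. V \<subseteq> U)) \<and>
          (\<Union>n. \<Union>(\<V> n)) = topspace X))"

end

theory Submission
  imports Defs
begin

text \<open>
  Suppose \<open>h\<close> is a homeomorphism from \<open>C_p(K)\<close> onto \<open>C_w(L)\<close>. If \<open>L\<close> is finite, then \<open>C_w(L)\<close> is
  locally compact while \<open>C_p(K)\<close> is not. If \<open>L\<close> is infinite, the functionals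
  \<open>\<mu>_t(g) = \<Sum>i. t_i g(y_i) / 2^i\<close> for distinct points \<open>y_i\<close> of \<open>L\<close> embed the Hilbert cube into the
  dual of \<open>C(L)\<close>. Say that a finite \<open>A \<subseteq> K\<close> controls \<open>t\<close> at scale \<open>1/m\<close> if \<open>\<mu>_t\<close> varies by at
  most \<open>1\<close> from its value at \<open>h(0)\<close> on the image of all \<open>f\<close> with \<open>|f| < 1/m\<close> on \<open>A\<close>. Continuity of
  \<open>h\<close> at \<open>0\<close> shows that every \<open>t\<close> is controlled by some \<open>A\<close>; openness of \<open>h\<close> at \<open>0\<close> shows that the
  set of \<open>t\<close> controlled by a given \<open>A\<close> embeds into a Euclidean space. So the closed set \<open>E\<close> of pairs
  \<open>(t, x)\<close> with \<open>x \<in> K^n\<close> controlling \<open>t\<close> is a C-space, being fibred over \<open>K^n\<close> with C-space fibres.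
  When \<open>n\<close> is the minimal size of a controlling set, a \<open>\<Delta>\<close>-system argument shows that only
  finitely many sets of size \<open>n\<close> control \<open>t\<close>, so that \<open>E\<close> projects finite-to-one to the cube;
  since such projections preserve property C, the whole Hilbert cube would be a C-space. That it is
  not follows from Sperner's lemma.
\<close>

section \<open>Property C for subsets\<close>

definition disjoint_refinement :: "'a topology \<Rightarrow> 'a set set \<Rightarrow> 'a set set \<Rightarrow> bool" where
  "disjoint_refinement X \<U> \<V> \<longleftrightarrow>
     pairwise disjnt \<V> \<and> (\<forall>V\<in>\<V>. openin X V) \<and> (\<forall>V\<in>\<V>. \<exists>U\<in>\<U>. V \<subseteq> U)"

text \<open>
  Covers and refinements consist of open sets of the whole space. For subsets of metrizable spaces
  this agrees with property C of the subspace, and it passes between subsets without extending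
  open sets from subspaces.
\<close>

definition C_subset :: "'a topology \<Rightarrow> 'a set \<Rightarrow> bool" where
  "C_subset X S \<longleftrightarrow>
     (\<forall>\<U> :: nat \<Rightarrow> 'a set set. (\<forall>n. (\<forall>U\<in>\<U> n. openin X U) \<and> S \<subseteq> \<Union>(\<U> n)) \<longrightarrow>
       (\<exists>\<V> :: nat \<Rightarrow> 'a set set.
          (\<forall>n. disjoint_refinement X (\<U> n) (\<V> n)) \<and> S \<subseteq> (\<Union>n. \<Union>(\<V> n))))"

lemma C_subsetI:
  assumes "\<And>\<U>. (\<And>n U. U \<in> \<U> n \<Longrightarrow> openin X U) \<Longrightarrow> (\<And>n. S \<subseteq> \<Union>(\<U> n)) \<Longrightarrow>
     \<exists>\<V>. (\<forall>n::nat. disjoint_refinement X (\<U> n) (\<V> n)) \<and> S \<subseteq> (\<Union>n. \<Union>(\<V> n))"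
  shows "C_subset X S"
  unfolding C_subset_def
proof (intro allI impI)
  fix \<U> :: "nat \<Rightarrow> 'a set set"
  assume h: "\<forall>n. (\<forall>U\<in>\<U> n. openin X U) \<and> S \<subseteq> \<Union>(\<U> n)"
  show "\<exists>\<V>. (\<forall>n. disjoint_refinement X (\<U> n) (\<V> n)) \<and> S \<subseteq> (\<Union>n. \<Union>(\<V> n))"
  proof (rule assms)
    show "openin X U" if "U \<in> \<U> n" for n U using h that by simp
    show "S \<subseteq> \<Union>(\<U> n)" for n using h by simp
  qed
qed

lemma C_subsetD:
  assumes "C_subset X S" "\<And>n U. U \<in> \<U> n \<Longrightarrow> openin X U" "\<And>n. S \<subseteq> \<Union>(\<U> n)"
  shows "\<exists>\<V>. (\<forall>n::nat. disjoint_refinement X (\<U> n) (\<V> n)) \<and> S \<subseteq> (\<Union>n. \<Union>(\<V> n))"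
proof -
  have "\<forall>n. (\<forall>U\<in>\<U> n. openin X U) \<and> S \<subseteq> \<Union>(\<U> n)"
    by (intro allI conjI ballI) (rule assms, assumption, rule assms)
  then show ?thesis
    by (rule assms(1)[unfolded C_subset_def, THEN spec, THEN mp])
qed

lemma C_subsetE:
  assumes "C_subset X S" "\<And>n U. U \<in> \<U> n \<Longrightarrow> openin X U" "\<And>n. S \<subseteq> \<Union>(\<U> n)"
  obtains \<V> where "\<And>n::nat. disjoint_refinement X (\<U> n) (\<V> n)" "S \<subseteq> (\<Union>n. \<Union>(\<V> n))"
proof -
  have "\<exists>\<V>. (\<forall>n::nat. disjoint_refinement X (\<U> n) (\<V> n)) \<and> S \<subseteq> (\<Union>n. \<Union>(\<V> n))"
    by (rule C_subsetD[OF assms(1)]) (rule assms, assumption, rule assms)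
  then show thesis using that by blast
qed

lemma C_space_imp_C_subset:
  assumes "C_space X"
  shows "C_subset X (topspace X)"
proof (rule C_subsetI)
  fix \<U> :: "nat \<Rightarrow> 'a set set"
  assume o: "\<And>n U. U \<in> \<U> n \<Longrightarrow> openin X U" and c: "\<And>n. topspace X \<subseteq> \<Union>(\<U> n)"
  have "open_cover X (\<U> n)" for n
    unfolding open_cover_def using o c openin_subset by blast
  then show "\<exists>\<V>. (\<forall>n::nat. disjoint_refinement X (\<U> n) (\<V> n)) \<and> topspace X \<subseteq> (\<Union>n. \<Union>(\<V> n))"
    using assms[unfolded C_space_def, rule_format, of \<U>] unfolding disjoint_refinement_def
    by (metis (no_types, lifting) order_refl)
qed

text \<open>\<open>prod_encode\<close> divides the sequence of covers into countably many
  subsequences, and the \<open>j\<close>-th of them is spent on \<open>S j\<close>.\<close>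

lemma C_subset_UN:
  fixes S :: "nat \<Rightarrow> 'a set"
  assumes "\<And>j. C_subset X (S j)"
  shows "C_subset X (\<Union>j. S j)"
proof (rule C_subsetI)
  fix \<U> :: "nat \<Rightarrow> 'a set set"
  assume o: "\<And>n U. U \<in> \<U> n \<Longrightarrow> openin X U" and c: "\<And>n. (\<Union>j. S j) \<subseteq> \<Union>(\<U> n)"
  have "\<exists>\<V>. (\<forall>n::nat. disjoint_refinement X (\<U> (prod_encode (j,n))) (\<V> n)) \<and> S j \<subseteq> (\<Union>n. \<Union>(\<V> n))" for j
    by (rule C_subsetD[OF assms]) (use o c in blast)+
  then obtain \<V> where V: "\<And>j n::nat. disjoint_refinement X (\<U> (prod_encode (j,n))) (\<V> j n)"
    and S: "\<And>j. S j \<subseteq> (\<Union>n. \<Union>(\<V> j n))"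
    by metis
  define \<W> where "\<W> = (\<lambda>m. \<V> (fst (prod_decode m)) (snd (prod_decode m)))"
  have "disjoint_refinement X (\<U> m) (\<W> m)" for m
    using V[of "fst (prod_decode m)" "snd (prod_decode m)"] by (simp add: \<W>_def)
  moreover have "(\<Union>j. S j) \<subseteq> (\<Union>m. \<Union>(\<W> m))"
  proof
    fix x assume "x \<in> (\<Union>j. S j)"
    then obtain j n where "x \<in> \<Union>(\<V> j n)" using S by blast
    then have "x \<in> \<Union>(\<W> (prod_encode (j,n)))" by (simp add: \<W>_def)
    then show "x \<in> (\<Union>m. \<Union>(\<W> m))" by blast
  qed
  ultimately show "\<exists>\<V>. (\<forall>n. disjoint_refinement X (\<U> n) (\<V> n)) \<and> (\<Union>j. S j) \<subseteq> (\<Union>n. \<Union>(\<V> n))"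
    by blast
qed

lemma C_subset_empty [simp]: "C_subset X {}"
proof (rule C_subsetI)
  fix \<U> :: "nat \<Rightarrow> 'a set set"
  show "\<exists>\<V>. (\<forall>n. disjoint_refinement X (\<U> n) (\<V> n)) \<and> {} \<subseteq> (\<Union>n. \<Union>(\<V> n))"
    by (intro exI[of _ "\<lambda>_. {}"]) (auto simp: disjoint_refinement_def)
qed

lemma C_subset_Union:
  assumes "countable \<S>" "\<And>S. S \<in> \<S> \<Longrightarrow> C_subset X S"
  shows "C_subset X (\<Union>\<S>)"
proof (cases "\<S> = {}")
  case False
  then show ?thesis
    using C_subset_UN[of X "from_nat_into \<S>", OF assms(2)] from_nat_into[OF False]
    by (simp add: assms(1))
qed simp

text \<open>The inclusion, in place of an equation, suits fibres only known to have at most one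
  point.\<close>

lemma C_subset_singleton:
  assumes "S \<subseteq> {x}"
  shows "C_subset X S"
proof (cases "S = {}")
  case False
  with assms have S: "S = {x}" by blast
  show ?thesis
  proof (rule C_subsetI)
    fix \<U> :: "nat \<Rightarrow> 'a set set"
    assume o: "\<And>n U. U \<in> \<U> n \<Longrightarrow> openin X U" and c: "\<And>n. S \<subseteq> \<Union>(\<U> n)"
    have "\<exists>u. u \<in> \<U> n \<and> x \<in> u" for n
      using c[of n] S by blast
    then obtain f where "\<And>n. f n \<in> \<U> n \<and> x \<in> f n"
      by metis
    then show "\<exists>\<V>. (\<forall>n. disjoint_refinement X (\<U> n) (\<V> n)) \<and> S \<subseteq> (\<Union>n. \<Union>(\<V> n))"
      using o S by (intro exI[of _ "\<lambda>n. {f n}"]) (auto simp: disjoint_refinement_def)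
  qed
qed simp

text \<open>Adjoining the complement of \<open>S\<close> turns covers of \<open>S\<close> into
  covers of \<open>T\<close>. A refining set that meets \<open>S\<close> cannot lie in that
  complement, so keeping only the sets inside members of \<open>\<U> n\<close> loses no point of
  \<open>S\<close>.\<close>

lemma C_subset_closed_subset:
  assumes "C_subset X T" "closedin X S" "S \<subseteq> T" "T \<subseteq> topspace X"
  shows "C_subset X S"
proof (rule C_subsetI)
  fix \<U> :: "nat \<Rightarrow> 'a set set"
  assume o: "\<And>n U. U \<in> \<U> n \<Longrightarrow> openin X U" and c: "\<And>n. S \<subseteq> \<Union>(\<U> n)"
  obtain \<V> where V: "\<And>n::nat. disjoint_refinement X (insert (topspace X - S) (\<U> n)) (\<V> n)"
      and T: "T \<subseteq> (\<Union>n. \<Union>(\<V> n))"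
  proof (rule C_subsetE[OF assms(1), of "\<lambda>n. insert (topspace X - S) (\<U> n)"])
    show "T \<subseteq> \<Union>(insert (topspace X - S) (\<U> n))" for n
      using c[of n] assms(4) by blast
  qed (use o assms(2) in auto)
  define \<W> where "\<W> = (\<lambda>n. {V \<in> \<V> n. \<exists>U\<in>\<U> n. V \<subseteq> U})"
  have "disjoint_refinement X (\<U> n) (\<W> n)" for n
    using V[of n] unfolding disjoint_refinement_def \<W>_def
    by (auto intro: pairwise_subset)
  moreover have "S \<subseteq> (\<Union>n. \<Union>(\<W> n))"
  proof
    fix x assume x: "x \<in> S"
    then obtain n v where nv: "v \<in> \<V> n" "x \<in> v" using T assms(3) by blast
    then obtain u where "u \<in> insert (topspace X - S) (\<U> n)" "v \<subseteq> u"
      using V[of n] unfolding disjoint_refinement_def by blast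
    then have "v \<in> \<W> n" using nv x by (auto simp: \<W>_def)
    then show "x \<in> (\<Union>n. \<Union>(\<W> n))" using nv by blast
  qed
  ultimately show "\<exists>\<V>. (\<forall>n. disjoint_refinement X (\<U> n) (\<V> n)) \<and> S \<subseteq> (\<Union>n. \<Union>(\<V> n))"
    by blast
qed

text \<open>The even covers are spent on \<open>Z\<close>. What their refinements leave of
  \<open>T\<close> is closed and misses \<open>Z\<close>, so the odd covers handle it. A proof for
  \<open>T\<close> is thereby reduced to closed sets avoiding a known C-subset.\<close>

lemma C_subset_if_complement:
  assumes Z: "C_subset X Z" "Z \<subseteq> T" and T: "closedin X T"
    and F: "\<And>F. closedin X F \<Longrightarrow> F \<subseteq> T \<Longrightarrow> F \<inter> Z = {} \<Longrightarrow> C_subset X F"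
  shows "C_subset X T"
proof (rule C_subsetI)
  fix \<U> :: "nat \<Rightarrow> 'a set set"
  assume o: "\<And>n U. U \<in> \<U> n \<Longrightarrow> openin X U" and c: "\<And>n. T \<subseteq> \<Union>(\<U> n)"
  obtain \<V> where V: "\<And>n. disjoint_refinement X (\<U> (2*n)) (\<V> n)" "Z \<subseteq> (\<Union>n. \<Union>(\<V> n))"
  proof (rule C_subsetE[OF Z(1), of "\<lambda>n. \<U> (2*n)"])
    show "openin X U" if "U \<in> \<U> (2*n)" for n U using o that by simp
    show "Z \<subseteq> \<Union>(\<U> (2*n))" for n using c[of "2*n"] Z(2) by (rule subset_trans[rotated])
  qed blast
  define S where "S = T - (\<Union>n. \<Union>(\<V> n))"
  have "openin X (\<Union>n. \<Union>(\<V> n))"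
    using V(1) by (auto simp: disjoint_refinement_def)
  then have "C_subset X S"
    using V(2) T unfolding S_def by (intro F closedin_diff) auto
  then obtain \<W> where W: "\<And>n. disjoint_refinement X (\<U> (2*n+1)) (\<W> n)" "S \<subseteq> (\<Union>n. \<Union>(\<W> n))"
  proof (rule C_subsetE[of X S "\<lambda>n. \<U> (2*n+1)"])
    show "openin X U" if "U \<in> \<U> (2*n+1)" for n U using o that by simp
    show "S \<subseteq> \<Union>(\<U> (2*n+1))" for n using c[of "2*n+1"] S_def by blast
  qed blast
  define \<R> where "\<R> = (\<lambda>m. if even m then \<V> (m div 2) else \<W> (m div 2))"
  have "disjoint_refinement X (\<U> m) (\<R> m)" for m
    using V(1)[of "m div 2"] W(1)[of "m div 2"] by (auto simp: \<R>_def)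
  moreover have "T \<subseteq> (\<Union>m. \<Union>(\<R> m))"
  proof
    fix x assume x: "x \<in> T"
    have R: "\<R> (2*n) = \<V> n" "\<R> (2*n+1) = \<W> n" for n by (auto simp: \<R>_def)
    obtain n where "x \<in> \<Union>(\<V> n) \<or> x \<in> \<Union>(\<W> n)"
      using x W(2) unfolding S_def by blast
    then have "x \<in> \<Union>(\<R> (2*n)) \<or> x \<in> \<Union>(\<R> (2*n+1))" by (simp only: R)
    then show "x \<in> (\<Union>m. \<Union>(\<R> m))" by blast
  qed
  ultimately show "\<exists>\<V>. (\<forall>n. disjoint_refinement X (\<U> n) (\<V> n)) \<and> T \<subseteq> (\<Union>n. \<Union>(\<V> n))"
    by blast
qed

section \<open>Property C under closed maps\<close>

text \<open>For each \<open>j\<close>, the \<open>j\<close>-th subsequence of covers takes care of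
  the fibre over \<open>y\<close>, and closedness of \<open>f\<close> extends this to the part of
  \<open>S\<close> over a neighbourhood \<open>w y j\<close>. Property C of \<open>Y\<close>,
  applied to the covers by these neighbourhoods, yields disjoint families along which the local
  refinements are glued.\<close>

lemma C_subset_closed_map_preimage:
  assumes f: "closed_map X Y f" "continuous_map X Y f"
    and Y: "C_subset Y (topspace Y)" and S: "closedin X S"
    and fib: "\<And>y. y \<in> topspace Y \<Longrightarrow> C_subset X {x \<in> S. f x = y}"
  shows "C_subset X S"
proof (rule C_subsetI)
  fix \<U> :: "nat \<Rightarrow> 'a set set"
  assume o: "\<And>n U. U \<in> \<U> n \<Longrightarrow> openin X U" and c: "\<And>n. S \<subseteq> \<Union>(\<U> n)"
  \<comment> \<open>\<open>\<Phi> y j\<close> holds of a refinement of the \<open>j\<close>-th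
    subsequence together with a neighbourhood \<open>w\<close> of \<open>y\<close> over which this
    refinement covers \<open>S\<close>.\<close>
  define \<Phi> where "\<Phi> = (\<lambda>y j (\<V>,w). (\<forall>n. disjoint_refinement X (\<U> (prod_encode (j,n))) (\<V> n)) \<and>
    openin Y w \<and> y \<in> w \<and> {x\<in>S. f x \<in> w} \<subseteq> (\<Union>n. \<Union>(\<V> n)))"
  have "\<exists>p. \<Phi> y j p" if y: "y \<in> topspace Y" for y j
  proof -
    obtain \<V> where V: "\<And>n. disjoint_refinement X (\<U> (prod_encode (j,n))) (\<V> n)"
        "{x \<in> S. f x = y} \<subseteq> (\<Union>n. \<Union>(\<V> n))"
    proof (rule C_subsetE[OF fib[OF y], of "\<lambda>n. \<U> (prod_encode (j,n))"])
      show "openin X U" if "U \<in> \<U> (prod_encode (j,n))" for n U using o that by simp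
    qed (use c in blast)+
    define O' where "O' = (\<Union>n. \<Union>(\<V> n))"
    have "openin X O'"
      using V(1) by (auto simp: disjoint_refinement_def O'_def)
    then have "closedin Y (f ` (S - O'))"
      using f(1) S unfolding closed_map_def by blast
    then have "openin Y (topspace Y - f ` (S - O'))" by blast
    moreover have "y \<in> topspace Y - f ` (S - O')"
      using V(2) y by (auto simp: O'_def)
    moreover have "{x\<in>S. f x \<in> topspace Y - f ` (S - O')} \<subseteq> O'"
      by blast
    ultimately have "\<Phi> y j (\<V>, topspace Y - f ` (S - O'))"
      using V(1) unfolding O'_def \<Phi>_def by simp
    then show ?thesis ..
  qed
  then obtain g where g: "\<And>y j. y \<in> topspace Y \<Longrightarrow> \<Phi> y j (g y j)"
    by metis
  define \<V> where "\<V> = (\<lambda>y j. fst (g y j))"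
  define w where "w = (\<lambda>y j. snd (g y j))"
  have V: "\<And>y j n. y \<in> topspace Y \<Longrightarrow> disjoint_refinement X (\<U> (prod_encode (j,n))) (\<V> y j n)"
    and w: "\<And>y j. y \<in> topspace Y \<Longrightarrow> openin Y (w y j)" "\<And>y j. y \<in> topspace Y \<Longrightarrow> y \<in> w y j"
    and cov: "\<And>y j. y \<in> topspace Y \<Longrightarrow> {x\<in>S. f x \<in> w y j} \<subseteq> (\<Union>n. \<Union>(\<V> y j n))"
    using g by (auto simp: \<Phi>_def \<V>_def w_def split_beta)
  obtain \<W> where W: "\<And>j. disjoint_refinement Y ((\<lambda>y. w y j) ` topspace Y) (\<W> j)"
    and WY: "topspace Y \<subseteq> (\<Union>j. \<Union>(\<W> j))"
  proof (rule C_subsetE[OF Y, of "\<lambda>j. (\<lambda>y. w y j) ` topspace Y"])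
    show "topspace Y \<subseteq> \<Union>((\<lambda>y. w y j) ` topspace Y)" for j using w(2) by blast
  qed (use w(1) in auto)
  have "\<exists>y. y \<in> topspace Y \<and> W \<subseteq> w y j" if "W \<in> \<W> j" for W j
    using W[of j] that unfolding disjoint_refinement_def by blast
  then obtain c where c: "\<And>W j. W \<in> \<W> j \<Longrightarrow> c W j \<in> topspace Y \<and> W \<subseteq> w (c W j) j"
    by metis
  \<comment> \<open>Pieces over one \<open>W\<close> come from the single refinement
    \<open>\<V> (c W j) j n\<close>, and pieces over distinct \<open>W\<close> have disjoint images
    under \<open>f\<close>. These are the two cases of disjointness.\<close>
  define R where "R = (\<lambda>j n. {{x\<in>topspace X. f x \<in> W} \<inter> V | W V. W \<in> \<W> j \<and> V \<in> \<V> (c W j) j n})"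
  have R: "disjoint_refinement X (\<U> (prod_encode (j,n))) (R j n)" for j n
    unfolding disjoint_refinement_def
  proof (intro conjI ballI)
    show "pairwise disjnt (R j n)"
    proof (rule pairwiseI)
      fix A B assume "A \<in> R j n" "B \<in> R j n" "A \<noteq> B"
      then obtain W V W' V' where A: "A = {x\<in>topspace X. f x \<in> W} \<inter> V" "W \<in> \<W> j" "V \<in> \<V> (c W j) j n"
        and B: "B = {x\<in>topspace X. f x \<in> W'} \<inter> V'" "W' \<in> \<W> j" "V' \<in> \<V> (c W' j) j n"
        unfolding R_def by blast
      show "disjnt A B"
      proof (cases "W = W'")
        case True
        then have "V \<noteq> V'" using A B \<open>A \<noteq> B\<close> by blast
        then have "disjnt V V'"
          using True A(3) B(3) V[OF conjunct1[OF c[OF A(2)]], of j n]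
          unfolding disjoint_refinement_def by (auto simp: pairwise_def)
        then show ?thesis using A(1) B(1) by (auto simp: disjnt_def)
      next
        case False
        then have "disjnt W W'"
          using A(2) B(2) W[of j] unfolding disjoint_refinement_def by (auto simp: pairwise_def)
        then show ?thesis using A(1) B(1) by (auto simp: disjnt_def)
      qed
    qed
  next
    fix A assume "A \<in> R j n"
    then obtain W V where A: "A = {x\<in>topspace X. f x \<in> W} \<inter> V" "W \<in> \<W> j" "V \<in> \<V> (c W j) j n"
        unfolding R_def by blast
    have *: "openin X V" "\<exists>U\<in>\<U> (prod_encode (j,n)). V \<subseteq> U"
      using A(3) V[OF conjunct1[OF c[OF A(2)]], of j n] unfolding disjoint_refinement_def by auto
    have "openin Y W" using W[of j] A(2) unfolding disjoint_refinement_def by blast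
    then show "openin X A"
      unfolding A(1) using *(1) f(2) openin_continuous_map_preimage by blast
    show "\<exists>U\<in>\<U> (prod_encode (j,n)). A \<subseteq> U" using *(2) A(1) by blast
  qed
  define Q where "Q = (\<lambda>m. R (fst (prod_decode m)) (snd (prod_decode m)))"
  have "disjoint_refinement X (\<U> m) (Q m)" for m
    using R[of "fst (prod_decode m)" "snd (prod_decode m)"] by (simp add: Q_def)
  moreover have "S \<subseteq> (\<Union>m. \<Union>(Q m))"
  proof
    fix x assume x: "x \<in> S"
    then have x': "x \<in> topspace X" using S closedin_subset by blast
    then have "f x \<in> topspace Y" using f(2) by (auto simp: continuous_map_def)
    then obtain j W where W: "W \<in> \<W> j" "f x \<in> W" using WY by blast
    then obtain n V where "V \<in> \<V> (c W j) j n" "x \<in> V"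
      using c[OF W(1)] cov[of "c W j" j] x by blast
    then have "x \<in> \<Union>(R j n)" using W x' unfolding R_def by blast
    then have "x \<in> \<Union>(Q (prod_encode (j,n)))" by (simp add: Q_def)
    then show "x \<in> (\<Union>m. \<Union>(Q m))" by blast
  qed
  ultimately show "\<exists>\<V>. (\<forall>n. disjoint_refinement X (\<U> n) (\<V> n)) \<and> S \<subseteq> (\<Union>n. \<Union>(\<V> n))"
    by blast
qed

text \<open>\<open>e V\<close> is a union of balls with half the radius that \<open>V\<close>
  allows. If two such balls about points of \<open>V\<close> and \<open>W\<close> meet, then one
  centre lies in the full ball about the other, so \<open>V\<close> and \<open>W\<close> meet. This
  carries disjoint open sets of a subspace to disjoint open sets of the whole space.\<close>

lemma metrizable_space_extend_open:
  assumes "metrizable_space X" "S \<subseteq> topspace X"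
  obtains e where "\<And>V. openin X (e V)" "\<And>V. openin (subtopology X S) V \<Longrightarrow> V \<subseteq> e V"
    "\<And>V W. disjnt V W \<Longrightarrow> disjnt (e V) (e W)"
proof -
  obtain M d where "Metric_space M d" and X: "X = Metric_space.mtopology M d"
    using assms(1) unfolding metrizable_space_def by blast
  then interpret Metric_space M d by simp
  define e where "e = (\<lambda>V. \<Union>{mball x (r/2) | x r. x \<in> V \<inter> S \<and> 0 < r \<and> mball x r \<inter> S \<subseteq> V})"
  show thesis
  proof
    show "openin X (e V)" for V
      unfolding e_def X by (rule openin_Union) auto
    show "V \<subseteq> e V" if V: "openin (subtopology X S) V" for V
    proof
      fix x assume x: "x \<in> V"
      obtain U where U: "openin X U" "V = U \<inter> S"
        using V unfolding openin_subtopology by blast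
      then obtain r where r: "0 < r" "mball x r \<subseteq> U"
        using x unfolding X openin_mtopology by blast
      have "x \<in> M" using x U openin_subset X by fastforce
      then have "x \<in> mball x (r/2)" using r by simp
      moreover have "x \<in> V \<inter> S" "mball x r \<inter> S \<subseteq> V" using r U x by auto
      ultimately show "x \<in> e V" unfolding e_def using r by blast
    qed
    show "disjnt (e V) (e W)" if VW: "disjnt V W" for V W
    proof (rule ccontr)
      assume "\<not> ?thesis"
      then obtain z where "z \<in> e V" "z \<in> e W" by (auto simp: disjnt_def)
      then obtain x r y s where x: "z \<in> mball x (r/2)" "x \<in> V" "x \<in> S" "0 < r" "mball x r \<inter> S \<subseteq> V"
        and y: "z \<in> mball y (s/2)" "y \<in> W" "y \<in> S" "0 < s" "mball y s \<inter> S \<subseteq> W"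
        unfolding e_def by blast
      have zM: "z \<in> M" "x \<in> M" "y \<in> M" using x y by auto
      then have "d x y < r \<or> d x y < s"
        using triangle[of x z y] x(1) y(1) by (auto simp: commute)
      then have "y \<in> mball x r \<or> x \<in> mball y s"
        using zM by (auto simp: commute)
      then show False using x y VW by (auto simp: disjnt_def)
    qed
  qed
qed

text \<open>By injectivity, the image of \<open>v \<inter> S\<close> is the complement in the image
  of \<open>S\<close> of the closed image of \<open>S - v\<close>. It is thus relatively open, and
  it can be extended to an open set of \<open>Y\<close>.\<close>

lemma C_subset_closed_inj_image:
  assumes f: "closed_map X Y f" "continuous_map X Y f" "inj_on f S"
    and X: "C_subset X S" and S: "closedin X S" and Y: "metrizable_space Y"
  shows "C_subset Y (f ` S)"
proof (rule C_subsetI)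
  fix \<U> :: "nat \<Rightarrow> 'b set set"
  assume o: "\<And>n U. U \<in> \<U> n \<Longrightarrow> openin Y U" and c: "\<And>n. f ` S \<subseteq> \<Union>(\<U> n)"
  have ST: "S \<subseteq> topspace X" using S closedin_subset by blast
  have fST: "f ` S \<subseteq> topspace Y" using f(2) ST by (auto simp: continuous_map_def)
  obtain \<V> where V: "\<And>n. disjoint_refinement X ((\<lambda>U. {x\<in>topspace X. f x \<in> U}) ` \<U> n) (\<V> n)"
    and VS: "S \<subseteq> (\<Union>n. \<Union>(\<V> n))"
  proof (rule C_subsetE[OF X, of "\<lambda>n. (\<lambda>U. {x\<in>topspace X. f x \<in> U}) ` \<U> n"])
    show "openin X U" if "U \<in> (\<lambda>U. {x\<in>topspace X. f x \<in> U}) ` \<U> n" for n U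
      using that o f(2) openin_continuous_map_preimage by blast
    show "S \<subseteq> \<Union>((\<lambda>U. {x\<in>topspace X. f x \<in> U}) ` \<U> n)" for n
      using c[of n] ST by blast
  qed blast
  obtain e where e: "\<And>V. openin Y (e V)" "\<And>V. openin (subtopology Y (f ` S)) V \<Longrightarrow> V \<subseteq> e V"
    "\<And>V W. disjnt V W \<Longrightarrow> disjnt (e V) (e W)"
    by (rule metrizable_space_extend_open[OF Y fST]) blast
  have "\<exists>U. U \<in> \<U> n \<and> f ` (V \<inter> S) \<subseteq> U" if "V \<in> \<V> n" for V n
    using V[of n] that unfolding disjoint_refinement_def by blast
  then obtain u where u: "\<And>V n. V \<in> \<V> n \<Longrightarrow> u V n \<in> \<U> n \<and> f ` (V \<inter> S) \<subseteq> u V n"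
    by metis
  \<comment> \<open>The extension by \<open>e\<close> keeps the images disjoint, and intersecting
    with \<open>u V n\<close> makes the family refine \<open>\<U> n\<close>.\<close>
  define \<W> where "\<W> = (\<lambda>n. (\<lambda>V. e (f ` (V \<inter> S)) \<inter> u V n) ` \<V> n)"
  have "disjoint_refinement Y (\<U> n) (\<W> n)" for n
    unfolding disjoint_refinement_def
  proof (intro conjI ballI)
    show "pairwise disjnt (\<W> n)"
      unfolding \<W>_def
    proof (rule pairwise_imageI)
      fix V V' assume V': "V \<in> \<V> n" "V' \<in> \<V> n" "V \<noteq> V'"
      then have "disjnt V V'"
        using V[of n] unfolding disjoint_refinement_def by (auto simp: pairwise_def)
      then have "disjnt (f ` (V \<inter> S)) (f ` (V' \<inter> S))"
        using f(3) unfolding disjnt_def inj_on_def by blast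
      from e(3)[OF this] show "disjnt (e (f ` (V \<inter> S)) \<inter> u V n) (e (f ` (V' \<inter> S)) \<inter> u V' n)"
        by (auto simp: disjnt_def)
    qed
  next
    fix W assume "W \<in> \<W> n"
    then obtain V where "V \<in> \<V> n" "W = e (f ` (V \<inter> S)) \<inter> u V n" unfolding \<W>_def by blast
    then show "openin Y W" "\<exists>U\<in>\<U> n. W \<subseteq> U"
      using u[of V n] e(1) o[of "u V n" n] by auto
  qed
  moreover have "f ` S \<subseteq> (\<Union>n. \<Union>(\<W> n))"
  proof
    fix y assume "y \<in> f ` S"
    then obtain x where x: "x \<in> S" "y = f x" by blast
    then obtain n v where v: "v \<in> \<V> n" "x \<in> v" using VS by blast
    have "openin X v" using V[of n] v unfolding disjoint_refinement_def by blast
    then have "closedin Y (f ` (S - v))"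
      using f(1) S unfolding closed_map_def by blast
    then have "openin (subtopology Y (f ` S)) ((topspace Y - f ` (S - v)) \<inter> f ` S)"
      by (auto simp: openin_subtopology)
    moreover have "(topspace Y - f ` (S - v)) \<inter> f ` S = f ` (v \<inter> S)"
      using f(3) fST unfolding inj_on_def by blast
    ultimately have "f ` (v \<inter> S) \<subseteq> e (f ` (v \<inter> S))" using e(2) by simp
    then have "y \<in> e (f ` (v \<inter> S)) \<inter> u v n" using u[OF v(1)] x v by blast
    then show "y \<in> (\<Union>n. \<Union>(\<W> n))" using v unfolding \<W>_def by blast
  qed
  ultimately show "\<exists>\<V>. (\<forall>n. disjoint_refinement Y (\<U> n) (\<V> n)) \<and> f ` S \<subseteq> (\<Union>n. \<Union>(\<V> n))"
    by blast
qed

text \<open>Induction on \<open>n\<close>: the last map is closed, and its fibres are C by the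
  induction hypothesis for the remaining maps. It serves for the coordinates of a finite power of
  \<open>K\<close> and for finitely many real functionals.\<close>

lemma C_subset_finitely_many_maps:
  fixes f :: "nat \<Rightarrow> 'a \<Rightarrow> 'b"
  assumes f: "\<And>i. i < n \<Longrightarrow> continuous_map X Y (f i)"
    and X: "compact_space X" and Y: "Hausdorff_space Y" "C_subset Y (topspace Y)"
    and S: "closedin X S"
    and fib: "\<And>y. (\<And>i. i < n \<Longrightarrow> y i \<in> topspace Y) \<Longrightarrow> C_subset X {x \<in> S. \<forall>i<n. f i x = y i}"
  shows "C_subset X S"
  using assms
proof (induction n arbitrary: S)
  case 0
  then show ?case by simp
next
  case (Suc n)
  show ?case
  proof (rule C_subset_closed_map_preimage)
    show cont: "continuous_map X Y (f n)" using Suc.prems by simp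
    show "closed_map X Y (f n)"
      using cont Suc.prems continuous_imp_closed_map by blast
    fix z assume z: "z \<in> topspace Y"
    have S': "{x \<in> S. f n x = z} = S \<inter> {x \<in> topspace X. f n x \<in> {z}}"
      using closedin_subset[OF Suc.prems(5)] by blast
    have clo: "closedin X {x \<in> S. f n x = z}"
      unfolding S' using Suc.prems z cont
      by (intro closedin_Int closedin_continuous_map_preimage[OF cont])
        (auto simp: closedin_Hausdorff_singleton)
    show "C_subset X {x \<in> S. f n x = z}"
    proof (rule Suc.IH)
      fix y assume y: "\<And>i. i < n \<Longrightarrow> y i \<in> topspace Y"
      have "{x \<in> {x \<in> S. f n x = z}. \<forall>i<n. f i x = y i} = {x \<in> S. \<forall>i<Suc n. f i x = (y(n:=z)) i}"
        by (auto simp: less_Suc_eq)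
      moreover have "C_subset X {x \<in> S. \<forall>i<Suc n. f i x = (y(n:=z)) i}"
        by (rule Suc.prems(6)) (use y z in \<open>auto simp: less_Suc_eq\<close>)
      ultimately show "C_subset X {x \<in> {x \<in> S. f n x = z}. \<forall>i<n. f i x = y i}"
        by simp
    qed (use Suc.prems clo in auto)
  qed (use Suc.prems in auto)
qed

section \<open>Property C of the real line\<close>

text \<open>The grid points \<open>i/k\<close> are rational, so the open intervals between them are
  disjoint and cover \<open>F\<close>. With mesh below a Lebesgue number of the first cover, the
  trace of \<open>F\<close> on each interval lies in one of its members, and the later families can
  be empty.\<close>

lemma C_subset_compact_real_avoiding_rationals:
  fixes F :: "real set"
  assumes "compact F" "F \<inter> \<rat> = {}"
  shows "C_subset euclideanreal F"
proof (rule C_subsetI)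
  fix \<U> :: "nat \<Rightarrow> real set set"
  assume o: "\<And>n U. U \<in> \<U> n \<Longrightarrow> openin euclideanreal U" and c: "\<And>n. F \<subseteq> \<Union>(\<U> n)"
  show "\<exists>\<V>. (\<forall>n. disjoint_refinement euclideanreal (\<U> n) (\<V> n)) \<and> F \<subseteq> (\<Union>n. \<Union>(\<V> n))"
  proof (cases "F = {}")
    case True
    then show ?thesis
      by (intro exI[of _ "\<lambda>_. {}"]) (auto simp: disjoint_refinement_def)
  next
    case False
    have "\<U> 0 \<noteq> {}" using c[of 0] False by auto
    then obtain \<delta> where \<delta>: "0 < \<delta>" "\<And>T. \<lbrakk>T \<subseteq> F; diameter T < \<delta>\<rbrakk> \<Longrightarrow> \<exists>B \<in> \<U> 0. T \<subseteq> B"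
      using Lebesgue_number_lemma[OF assms(1), of "\<U> 0"] o c by (metis open_openin)
    obtain N where N: "1 / real (Suc N) < \<delta>" using \<delta>(1) nat_approx_posE by blast
    define k where "k = real (Suc N)"
    have k: "k > 0" "1/k < \<delta>" "k \<in> \<rat>" using N by (auto simp: k_def)
    define I where "I = (\<lambda>i::int. {i/k<..<(i+1)/k})"
    have dI: "disjnt (I i) (I j)" if "i < j" for i j
    proof -
      have "(i+1)/k \<le> j/k" using that k by (intro divide_right_mono) auto
      then show ?thesis by (auto simp: I_def disjnt_def)
    qed
    have "\<exists>U. U \<in> \<U> 0 \<and> F \<inter> I i \<subseteq> U" for i
    proof -
      have "diameter (F \<inter> I i) \<le> 1/k"
      proof (rule diameter_le)
        show "F \<inter> I i \<noteq> {} \<or> 0 \<le> 1/k" using k by auto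
        show "norm (x - y) \<le> 1/k" if "x \<in> F \<inter> I i" "y \<in> F \<inter> I i" for x y
          using that by (auto simp: I_def add_divide_distrib)
      qed
      then show ?thesis using \<delta>(2)[of "F \<inter> I i"] k by force
    qed
    then obtain u where u: "\<And>i. u i \<in> \<U> 0" "\<And>i. F \<inter> I i \<subseteq> u i" by metis
    define \<V> where "\<V> = (\<lambda>n::nat. if n = 0 then (\<lambda>i. I i \<inter> u i) ` UNIV else {})"
    have "disjoint_refinement euclideanreal (\<U> n) (\<V> n)" for n
    proof (cases "n = 0")
      case True
      have "pairwise disjnt ((\<lambda>i. I i \<inter> u i) ` UNIV)"
      proof (rule pairwise_imageI)
        fix i j :: int assume "i \<noteq> j"
        then show "disjnt (I i \<inter> u i) (I j \<inter> u j)"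
          using dI[of i j] dI[of j i] by (auto simp: disjnt_def not_less_iff_gr_or_eq linorder_neq_iff)
      qed
      then show ?thesis using True u(1) o[of _ 0]
        by (auto simp: disjoint_refinement_def \<V>_def I_def)
    qed (auto simp: disjoint_refinement_def \<V>_def)
    moreover have "F \<subseteq> (\<Union>n. \<Union>(\<V> n))"
    proof
      fix x assume x: "x \<in> F"
      define i where "i = \<lfloor>x * k\<rfloor>"
      have "x \<noteq> i/k" using x assms(2) k(3) by (metis Rats_divide Rats_of_int disjoint_iff)
      moreover have "i/k \<le> x" "x < (i+1)/k"
        using k(1) unfolding i_def by (auto simp: divide_simps)
      ultimately have "x \<in> I i" by (auto simp: I_def)
      then have "x \<in> \<Union>(\<V> 0)" using u(2) x by (auto simp: \<V>_def)
      then show "x \<in> (\<Union>n. \<Union>(\<V> n))" by blast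
    qed
    ultimately show ?thesis by blast
  qed
qed

text \<open>On each interval \<open>{-real n..real n}\<close> the rationals form a countable union
  of singletons, and the closed sets avoiding them are compact.\<close>

lemma C_subset_real: "C_subset euclideanreal UNIV"
proof -
  have "C_subset euclideanreal {-real n..real n}" for n
  proof (rule C_subset_if_complement)
    have "countable ({-real n..real n} \<inter> \<rat>)" using countable_rat by blast
    then show "C_subset euclideanreal ({-real n..real n} \<inter> \<rat>)"
      using C_subset_Union[of "(\<lambda>x. {x}) ` ({-real n..real n} \<inter> \<rat>)" euclideanreal]
      by (auto intro: C_subset_singleton)
  next
    fix F assume F: "closedin euclideanreal F" "F \<subseteq> {-real n..real n}" "F \<inter> ({-real n..real n} \<inter> \<rat>) = {}"
    then have "compact F"
      using compact_eq_bounded_closed bounded_subset[OF bounded_closed_interval] closed_closedin by metis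
    then show "C_subset euclideanreal F"
      by (rule C_subset_compact_real_avoiding_rationals) (use F in blast)
  qed auto
  then have "C_subset euclideanreal (\<Union>n. {-real n..real n})"
    by (rule C_subset_UN)
  moreover have "(\<Union>n. {-real n..real n}) = UNIV"
  proof -
    have "\<exists>n. x \<in> {-real n..real n}" for x :: real
    proof -
      obtain n where "\<bar>x\<bar> \<le> real n" using real_arch_simple by blast
      then have "x \<in> {-real n..real n}" by (auto simp: abs_le_iff)
      then show ?thesis ..
    qed
    then show ?thesis by blast
  qed
  ultimately show ?thesis by simp
qed

section \<open>Finite-to-one images\<close>

text \<open>The family consists of the closed balls of radius \<open>1 / real (Suc n)\<close> about
  the points of finite nets.\<close>

lemma compact_metrizable_separating_family:
  assumes "compact_space X" "metrizable_space X"
  obtains \<B> where "countable \<B>" "\<And>B. B \<in> \<B> \<Longrightarrow> closedin X B"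
    "\<And>x y. \<lbrakk>x \<in> topspace X; y \<in> topspace X; x \<noteq> y\<rbrakk> \<Longrightarrow>
        \<exists>B\<in>\<B>. \<exists>B'\<in>\<B>. x \<in> B \<and> y \<in> B' \<and> B \<inter> B' = {}"
proof -
  obtain M d where "Metric_space M d" and X: "X = Metric_space.mtopology M d"
    using assms(2) unfolding metrizable_space_def by blast
  then interpret Metric_space M d by simp
  have "compactin mtopology M"
    using assms(1) X by (simp add: compact_space_def)
  then have "mtotally_bounded M"
    by (rule compactin_imp_mtotally_bounded)
  then have "\<exists>A. finite A \<and> A \<subseteq> M \<and> M \<subseteq> (\<Union>x\<in>A. mball x (1 / real (Suc n)))" for n
    unfolding mtotally_bounded_def by simp
  then obtain A where A: "\<And>n. finite (A n)" "\<And>n. A n \<subseteq> M" "\<And>n. M \<subseteq> (\<Union>x\<in>A n. mball x (1 / real (Suc n)))"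
    by metis
  define \<B> where "\<B> = (\<Union>n. (\<lambda>x. mcball x (1 / real (Suc n))) ` A n)"
  show thesis
  proof
    show "countable \<B>" unfolding \<B>_def using A(1) by (intro countable_UN) (auto intro: countable_finite)
    show "closedin X B" if "B \<in> \<B>" for B using that unfolding \<B>_def X by auto
    fix x y assume "x \<in> topspace X" "y \<in> topspace X" "x \<noteq> y"
    then have xy: "x \<in> M" "y \<in> M" "x \<noteq> y" using X by auto
    \<comment> \<open>A common point of the two closed balls would bound \<open>d x y\<close> by
      four radii.\<close>
    then have "0 < d x y / 4" by simp
    then obtain n where n: "1 / real (Suc n) < d x y / 4" using nat_approx_posE by blast
    obtain a b where ab: "a \<in> A n" "x \<in> mball a (1 / real (Suc n))" "b \<in> A n" "y \<in> mball b (1 / real (Suc n))"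
      using A(3) xy by blast
    have "mcball a (1 / real (Suc n)) \<inter> mcball b (1 / real (Suc n)) = {}"
    proof (rule ccontr)
      assume "\<not> ?thesis"
      then obtain z where z: "z \<in> mcball a (1 / real (Suc n))" "z \<in> mcball b (1 / real (Suc n))" by blast
      have M: "a \<in> M" "b \<in> M" "z \<in> M" using ab z by auto
      have "d x y \<le> d x a + d a z + d z b + d b y"
        using triangle[of x a y] triangle[of a z y] triangle[of z b y] M xy by linarith
      then show False
        using z ab n by (simp add: commute)
    qed
    moreover have "x \<in> mcball a (1 / real (Suc n))" "y \<in> mcball b (1 / real (Suc n))"
      using ab(2,4) mball_subset_mcball by blast+
    moreover have "mcball a (1 / real (Suc n)) \<in> \<B>" "mcball b (1 / real (Suc n)) \<in> \<B>"
      using ab unfolding \<B>_def by blast+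
    ultimately show "\<exists>B\<in>\<B>. \<exists>B'\<in>\<B>. x \<in> B \<and> y \<in> B' \<and> B \<inter> B' = {}"
      by blast
  qed
qed

text \<open>
  If all the sets \<open>T'\<close> arising from disjoint \<open>D'\<close>, \<open>D''\<close> of a countable separating family were C, then
  so would be the set of points of \<open>T\<close> with at least two preimages in \<open>D\<close>; off that set \<open>f\<close> is
  injective on \<open>D\<close>, so \<open>T\<close> would be C. Iterating the split produces an infinite fibre.
\<close>

lemma non_C_subset_split:
  assumes f: "continuous_map X Y f" and X: "compact_space X" "metrizable_space X"
    and Y: "metrizable_space Y"
    and D: "closedin X D" "C_subset X D" and T: "closedin Y T" "T \<subseteq> f ` D" "\<not> C_subset Y T"
  obtains T' D' D'' where "closedin Y T'" "\<not> C_subset Y T'" "T' \<subseteq> T" "T' \<subseteq> f ` D'" "T' \<subseteq> f ` D''"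
    "closedin X D'" "D' \<subseteq> D" "D'' \<subseteq> D" "D' \<inter> D'' = {}"
proof -
  have cf: "closed_map X Y f"
    using f X(1) Y continuous_imp_closed_map metrizable_imp_Hausdorff_space by blast
  obtain \<B> where B: "countable \<B>" "\<And>B. B \<in> \<B> \<Longrightarrow> closedin X B"
    "\<And>x y. \<lbrakk>x \<in> topspace X; y \<in> topspace X; x \<noteq> y\<rbrakk> \<Longrightarrow>
        \<exists>B\<in>\<B>. \<exists>B'\<in>\<B>. x \<in> B \<and> y \<in> B' \<and> B \<inter> B' = {}"
    by (rule compact_metrizable_separating_family[OF X]) blast
  define W where "W = (\<lambda>(B,B'). T \<inter> f ` (D \<inter> B) \<inter> f ` (D \<inter> B'))"
  define I where "I = {(B,B'). B \<in> \<B> \<and> B' \<in> \<B> \<and> B \<inter> B' = {}}"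
  have "\<exists>p\<in>I. \<not> C_subset Y (W p)"
  proof (rule ccontr)
    assume "\<not> ?thesis"
    then have all: "\<And>p. p \<in> I \<Longrightarrow> C_subset Y (W p)" by blast
    have "C_subset Y T"
    proof (rule C_subset_if_complement)
      have "I \<subseteq> \<B> \<times> \<B>" by (auto simp: I_def)
      then have "countable I" using B(1) by (meson countable_SIGMA countable_subset)
      then show "C_subset Y (\<Union>(W ` I))"
        by (intro C_subset_Union) (use all in auto)
      show "\<Union>(W ` I) \<subseteq> T" by (auto simp: W_def)
      fix F assume F: "closedin Y F" "F \<subseteq> T" "F \<inter> \<Union>(W ` I) = {}"
      define E where "E = D \<inter> {x \<in> topspace X. f x \<in> F}"
      have DX: "D \<subseteq> topspace X" using D(1) closedin_subset by blast
      have E: "closedin X E"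
        unfolding E_def using D(1) F(1) f closedin_continuous_map_preimage by blast
      have "inj_on f E"
      proof (rule inj_onI, rule ccontr)
        fix x y assume xy: "x \<in> E" "y \<in> E" "f x = f y" "x \<noteq> y"
        then obtain B B' where "B \<in> \<B>" "B' \<in> \<B>" "x \<in> B" "y \<in> B'" "B \<inter> B' = {}"
          using B(3)[of x y] unfolding E_def by blast
        moreover have "f x \<in> f ` (D \<inter> B)" "f x \<in> f ` (D \<inter> B')" "f x \<in> T"
          using xy F(2) calculation unfolding E_def by (blast, auto)
        ultimately have "(B,B') \<in> I" "f x \<in> W (B,B')"
          by (auto simp: I_def W_def)
        then show False using F(3) xy(1) by (auto simp: E_def)
      qed
      moreover have "f ` E = F"
        using F(2) T(2) DX unfolding E_def by blast
      moreover have "C_subset X E"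
        by (rule C_subset_closed_subset[OF D(2) E]) (use DX in \<open>auto simp: E_def\<close>)
      ultimately show "C_subset Y F"
        using C_subset_closed_inj_image[OF cf f _ _ E Y] by metis
    qed (use T in auto)
    then show False using T(3) by blast
  qed
  then obtain B B' where BB: "(B,B') \<in> I" "\<not> C_subset Y (W (B,B'))" by auto
  then have Bc: "closedin X B" "closedin X B'" "B \<inter> B' = {}" using B(2) by (auto simp: I_def)
  show thesis
  proof
    show "closedin Y (W (B,B'))"
      using T(1) cf D(1) Bc unfolding W_def closed_map_def by (simp add: closedin_Int)
    show "closedin X (D \<inter> B)" using D(1) Bc by blast
    show "W (B,B') \<subseteq> T" "W (B,B') \<subseteq> f ` (D \<inter> B)" "W (B,B') \<subseteq> f ` (D \<inter> B')" by (auto simp: W_def)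
  qed (use BB Bc in auto)
qed

text \<open>Were the image not C, repeated splitting would give nested closed sets
  \<open>T n\<close> that are not C, together with pairwise disjoint sets \<open>E (Suc n)\<close>
  whose images contain \<open>T (Suc n)\<close>. A point common to all \<open>T n\<close> has a
  preimage in each of these disjoint sets.\<close>

lemma C_subset_finite_to_one_image:
  assumes f: "continuous_map X Y f" and X: "compact_space X" "metrizable_space X"
    and Y: "compact_space Y" "metrizable_space Y"
    and S: "closedin X S" "C_subset X S"
    and fin: "\<And>y. finite {x \<in> S. f x = y}"
  shows "C_subset Y (f ` S)"
proof (rule ccontr)
  assume nC: "\<not> C_subset Y (f ` S)"
  have cf: "closed_map X Y f"
    using f X(1) Y continuous_imp_closed_map metrizable_imp_Hausdorff_space by blast
  \<comment> \<open>In a triple \<open>(T,D,E)\<close>, \<open>D\<close> is the part of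
    \<open>S\<close> kept for further splitting and \<open>E\<close> is the part just split off. The
    empty \<open>E\<close> of the first triple is a placeholder.\<close>
  define P where "P = (\<lambda>(T,D,E::'a set). closedin Y T \<and> \<not> C_subset Y T \<and> T \<subseteq> f ` D \<and> closedin X D \<and> D \<subseteq> S)"
  define Q where "Q = (\<lambda>(T,D,E::'a set) (T',D',E'). T' \<subseteq> T \<and> T' \<subseteq> f ` E' \<and> D' \<subseteq> D \<and> E' \<subseteq> D \<and> D' \<inter> E' = {})"
  have "P (f ` S, S, {})"
    using nC S cf unfolding P_def closed_map_def by auto
  moreover have "\<exists>q. P q \<and> Q p q" if "P p" for p
  proof -
    obtain T D E where p: "p = (T,D,E)" by (cases p)
    have SX: "S \<subseteq> topspace X" using S(1) closedin_subset by blast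
    have *: "closedin Y T" "\<not> C_subset Y T" "T \<subseteq> f ` D" "closedin X D" "D \<subseteq> S"
      using that p by (auto simp: P_def)
    have "C_subset X D" by (rule C_subset_closed_subset[OF S(2) *(4,5) SX])
    then obtain T' D' D'' where "closedin Y T'" "\<not> C_subset Y T'" "T' \<subseteq> T" "T' \<subseteq> f ` D'" "T' \<subseteq> f ` D''"
      "closedin X D'" "D' \<subseteq> D" "D'' \<subseteq> D" "D' \<inter> D'' = {}"
      using non_C_subset_split[OF f X Y(2) *(4) _ *(1,3,2)] by blast
    then have "P (T',D',D'')" "Q p (T',D',D'')"
      using *(5) by (auto simp: P_def Q_def p)
    then show ?thesis by blast
  qed
  ultimately obtain s where s: "\<And>n::nat. P (s n)" "\<And>n. Q (s n) (s (Suc n))"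
    using dependent_nat_choice[of "\<lambda>_. P" "\<lambda>_. Q"] by metis
  define T where "T = (\<lambda>n. fst (s n))"
  define D where "D = (\<lambda>n. fst (snd (s n)))"
  define E where "E = (\<lambda>n. snd (snd (s n)))"
  have P: "closedin Y (T n)" "\<not> C_subset Y (T n)" "D n \<subseteq> S" for n
    using s(1)[of n] by (auto simp: P_def T_def D_def split: prod.splits)
  have Q: "T (Suc n) \<subseteq> T n" "T (Suc n) \<subseteq> f ` E (Suc n)" "D (Suc n) \<subseteq> D n" "E (Suc n) \<subseteq> D n"
      "D (Suc n) \<inter> E (Suc n) = {}" for n
    using s(2)[of n] by (auto simp: Q_def T_def D_def E_def split: prod.splits)
  have dec: "decseq T" "decseq D"
    by (rule decseq_SucI, rule Q)+
  \<comment> \<open>The sets are nonempty because the empty set is C.\<close>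
  have "(\<Inter>n. T n) \<noteq> {}"
  proof (rule compact_space_imp_nest[OF Y(1)])
    show "T n \<noteq> {}" for n using P(2)[of n] by auto
  qed (use P dec in auto)
  then obtain y where y: "\<And>n. y \<in> T n" by blast
  have "\<exists>x. x \<in> E (Suc n) \<and> f x = y" for n
    using y[of "Suc n"] Q(2)[of n] by blast
  then obtain x where x: "\<And>n. x n \<in> E (Suc n)" "\<And>n. f (x n) = y" by metis
  have "x m \<noteq> x n" if "m < n" for m n
  proof -
    have "x n \<in> D n" using x(1) Q(4) by blast
    then have "x n \<in> D (Suc m)" using decseqD[OF dec(2), of "Suc m" n] that by auto
    then show ?thesis using x(1)[of m] Q(5)[of m] by auto
  qed
  then have "inj x" by (meson linorder_injI)
  moreover have "range x \<subseteq> {z \<in> S. f z = y}"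
    using x Q(4) P(3) by blast
  ultimately show False
    using fin finite_subset range_inj_infinite by metis
qed

section \<open>The Hilbert cube\<close>

definition Hilbert_cube :: "(nat \<Rightarrow> real) set" where
  "Hilbert_cube = {x. \<forall>i. x i \<in> {0..1}}"

lemma compact_Hilbert_cube: "compact Hilbert_cube"
proof -
  have "compactin (product_topology (\<lambda>_::nat. euclideanreal) UNIV) (PiE UNIV (\<lambda>_. {0..1}))"
    by (simp add: compactin_PiE)
  moreover have "PiE UNIV (\<lambda>_. {0..1}) = Hilbert_cube"
    by (auto simp: Hilbert_cube_def PiE_UNIV_domain)
  ultimately show ?thesis
    by (simp add: euclidean_product_topology flip: compactin_euclidean_iff)
qed

text \<open>Translates smallness in the product metric into a uniform bound on coordinates, which is
  what the grid argument in the cube provides.\<close>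

lemma diameter_less_if_coordinates_close:
  assumes "0 < (\<delta>::real)"
  obtains \<epsilon> where "0 < \<epsilon>"
    "\<And>S::(nat \<Rightarrow> real) set. (\<And>x y i. \<lbrakk>x \<in> S; y \<in> S\<rbrakk> \<Longrightarrow> \<bar>x i - y i\<bar> \<le> \<epsilon>) \<Longrightarrow> diameter S < \<delta>"
\<comment> \<open>The product distance is at most twice the largest of finitely many coordinate
  distances plus a tail \<open>(1/2)^M\<close>. Here this gives
  \<open>2 * \<delta>/8 + \<delta>/4 = \<delta>/2\<close>.\<close>
proof (rule that[of "\<delta>/8"])
  show "0 < \<delta>/8" using assms by simp
  obtain M where M: "(1/2)^M < \<delta>/4"
    using real_arch_pow_inv[of "\<delta>/4" "1/2"] assms by auto
  fix S :: "(nat \<Rightarrow> real) set"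
  assume S: "\<And>x y i. \<lbrakk>x \<in> S; y \<in> S\<rbrakk> \<Longrightarrow> \<bar>x i - y i\<bar> \<le> \<delta>/8"
  have "dist x y \<le> \<delta>/2" if "x \<in> S" "y \<in> S" for x y
  proof -
    have "Max {dist (x (from_nat n)) (y (from_nat n))|n. n \<le> M} \<le> \<delta>/8"
    proof (subst Max_le_iff)
      show "finite {dist (x (from_nat n)) (y (from_nat n))|n. n \<le> M}" by simp
    qed (use S[OF that] in \<open>auto simp: dist_real_def\<close>)
    then show ?thesis
      using dist_fun_le_dist_first_terms[of x y M] M by linarith
  qed
  then have "diameter S \<le> \<delta>/2"
  proof (cases "S = {}")
    case False
    then have "(SUP (x,y)\<in>S \<times> S. dist x y) \<le> \<delta>/2"
      using \<open>\<And>x y. \<lbrakk>x \<in> S; y \<in> S\<rbrakk> \<Longrightarrow> dist x y \<le> \<delta>/2\<close> by (intro cSUP_least) auto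
    then show ?thesis using False by (simp add: diameter_def)
  qed (use assms in \<open>simp add: diameter_def\<close>)
  then show "diameter S < \<delta>" using assms by simp
qed

text \<open>The \<open>n\<close>-th cover consists of the complements of the two faces in direction
  \<open>n\<close>. Disjoint refinements covering the cube would, by compactness, already cover it
  with finitely many indices, and Kuhn's combinatorial lemma on a grid in those directions excludes
  this.\<close>

lemma not_C_subset_Hilbert_cube: "\<not> C_subset (top_of_set Hilbert_cube) Hilbert_cube"
proof
  let ?H = "top_of_set Hilbert_cube"
  assume C: "C_subset ?H Hilbert_cube"
  define lo where "lo = (\<lambda>n. Hilbert_cube \<inter> {x. x n < 1})"
  define hi where "hi = (\<lambda>n. Hilbert_cube \<inter> {x. 0 < x n})"
  have o: "openin ?H (lo n)" "openin ?H (hi n)" for n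
    unfolding lo_def hi_def
    by (intro openin_open_Int open_Collect_less continuous_intros continuous_on_product_coordinates)+
  obtain \<V> where V: "\<And>n. disjoint_refinement ?H {lo n, hi n} (\<V> n)" "Hilbert_cube \<subseteq> (\<Union>n. \<Union>(\<V> n))"
  proof (rule C_subsetE[OF C, of "\<lambda>n. {lo n, hi n}"])
    show "Hilbert_cube \<subseteq> \<Union>{lo n, hi n}" for n
      by (auto simp: lo_def hi_def Hilbert_cube_def)
  qed (use o in auto)
  define \<O> where "\<O> = {U. open U \<and> (\<exists>n. Hilbert_cube \<inter> U \<in> \<V> n)}"
  have "Hilbert_cube \<subseteq> \<Union>\<O>"
  proof
    fix x assume x: "x \<in> Hilbert_cube"
    then obtain n v where v: "v \<in> \<V> n" "x \<in> v" using V(2) by blast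
    then have "openin ?H v" using V(1)[of n] by (auto simp: disjoint_refinement_def)
    then obtain U where "open U" "v = Hilbert_cube \<inter> U" by (auto simp: openin_open)
    then show "x \<in> \<Union>\<O>" using v by (auto simp: \<O>_def)
  qed
  then obtain \<O>' where O': "\<O>' \<subseteq> \<O>" "finite \<O>'" "Hilbert_cube \<subseteq> \<Union>\<O>'"
    using compact_Hilbert_cube unfolding compact_eq_Heine_Borel by (metis (no_types, lifting) \<O>_def mem_Collect_eq)
  have "\<forall>U\<in>\<O>'. \<exists>n. Hilbert_cube \<inter> U \<in> \<V> n" using O'(1) by (auto simp: \<O>_def)
  then obtain c where c: "\<And>U. U \<in> \<O>' \<Longrightarrow> Hilbert_cube \<inter> U \<in> \<V> (c U)" by metis
  \<comment> \<open>\<open>N\<close> exceeds the index of every set in the finite subcover, so a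
    grid in the first \<open>N\<close> coordinates suffices.\<close>
  obtain N where N: "\<And>U. U \<in> \<O>' \<Longrightarrow> c U < N"
    using finite_nat_set_iff_bounded[of "c ` \<O>'"] O'(2) by auto
  have "\<O>' \<noteq> {}" using O'(3) by (auto simp: Hilbert_cube_def)
  then obtain \<delta> where \<delta>: "0 < \<delta>" "\<And>T. \<lbrakk>T \<subseteq> Hilbert_cube; diameter T < \<delta>\<rbrakk> \<Longrightarrow> \<exists>B \<in> \<O>'. T \<subseteq> B"
  proof (rule Lebesgue_number_lemma[OF compact_Hilbert_cube, of \<O>'])
    show "open U" if "U \<in> \<O>'" for U using O'(1) that by (auto simp: \<O>_def)
  qed (use O' in auto)
  obtain \<epsilon> where \<epsilon>: "0 < \<epsilon>" "\<And>S::(nat\<Rightarrow>real) set. (\<And>x y i. \<lbrakk>x \<in> S; y \<in> S\<rbrakk> \<Longrightarrow> \<bar>x i - y i\<bar> \<le> \<epsilon>) \<Longrightarrow> diameter S < \<delta>"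
    by (rule diameter_less_if_coordinates_close[OF \<delta>(1)]) blast
  obtain p' where p': "1 / real (Suc p') < \<epsilon>" using \<epsilon>(1) nat_approx_posE by blast
  define p where "p = Suc p'"
  have p: "0 < p" "1 / real p < \<epsilon>" using p' by (auto simp: p_def)
  \<comment> \<open>The coordinates from \<open>N\<close> on are constantly 0. Taking
    \<open>min 1\<close> keeps \<open>pt x\<close> in the cube even when \<open>x\<close> leaves the
    grid.\<close>
  define pt where "pt = (\<lambda>(x::nat\<Rightarrow>nat) i. if i < N then min 1 (real (x i) / real p) else 0)"
  have pt: "pt x \<in> Hilbert_cube" for x by (auto simp: pt_def Hilbert_cube_def)
  \<comment> \<open>A member of \<open>\<V> n\<close> that does not lie in \<open>lo n\<close> must
    lie in \<open>hi n\<close>; this splits each family into two disjoint open sets.\<close>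
  define A where "A = (\<lambda>n. \<Union>{v \<in> \<V> n. v \<subseteq> lo n})"
  define B where "B = (\<lambda>n. \<Union>{v \<in> \<V> n. \<not> v \<subseteq> lo n})"
  have B: "B n \<subseteq> hi n" for n
    using V(1)[of n] by (auto simp: disjoint_refinement_def B_def)
  \<comment> \<open>Points in neither \<open>A i\<close> nor \<open>B i\<close> get the default
    value that respects the boundary conditions: 1 on the face \<open>x i = p\<close> and 0
    elsewhere.\<close>
  define label where "label = (\<lambda>x i. if pt x \<in> A i then 0 else if pt x \<in> B i then 1 else if x i = p then 1 else (0::nat))"
  \<comment> \<open>\<open>A n\<close> and \<open>B n\<close> miss opposite faces of the cube, so \<open>label\<close> satisfies the boundary conditions.
     A small cell lies in a single member of the cover, on which one coordinate of the label is
     constant.\<close>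
  obtain q where q: "\<forall>i<N. q i < p"
    "\<forall>i<N. \<exists>r s. (\<forall>j<N. q j \<le> r j \<and> r j \<le> q j + 1) \<and> (\<forall>j<N. q j \<le> s j \<and> s j \<le> q j + 1) \<and> label r i \<noteq> label s i"
  proof (rule kuhn_lemma[OF p(1), of N label])
    show "\<forall>x. (\<forall>i<N. x i \<le> p) \<longrightarrow> (\<forall>i<N. label x i = 0 \<or> label x i = 1)"
      by (auto simp: label_def)
    show "\<forall>x. (\<forall>i<N. x i \<le> p) \<longrightarrow> (\<forall>i<N. x i = 0 \<longrightarrow> label x i = 0)"
    proof (intro allI impI)
      fix x :: "nat \<Rightarrow> nat" and i assume "i < N" "x i = 0"
      then have "pt x \<notin> B i" using B[of i] by (auto simp: hi_def pt_def)
      then show "label x i = 0" using \<open>x i = 0\<close> p by (auto simp: label_def)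
    qed
    show "\<forall>x. (\<forall>i<N. x i \<le> p) \<longrightarrow> (\<forall>i<N. x i = p \<longrightarrow> label x i = 1)"
    proof (intro allI impI)
      fix x :: "nat \<Rightarrow> nat" and i assume "i < N" "x i = p"
      then have "pt x i = 1" using p(1) by (auto simp: pt_def)
      then have "pt x \<notin> A i" by (auto simp: A_def lo_def)
      then show "label x i = 1" using \<open>x i = p\<close> by (auto simp: label_def)
    qed
  qed blast
  define T where "T = {pt x | x. \<forall>j<N. q j \<le> x j \<and> x j \<le> q j + 1}"
  have "diameter T < \<delta>"
  proof (rule \<epsilon>(2))
    fix a b i assume "a \<in> T" "b \<in> T"
    then obtain x y where x: "a = pt x" "\<forall>j<N. q j \<le> x j \<and> x j \<le> q j + 1"
      and y: "b = pt y" "\<forall>j<N. q j \<le> y j \<and> y j \<le> q j + 1" unfolding T_def by blast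
    show "\<bar>a i - b i\<bar> \<le> \<epsilon>"
    proof (cases "i < N")
      case True
      have le: "real (z i) / real p \<le> real (q i) / real p + 1 / real p" "real (q i) / real p \<le> real (z i) / real p"
        if "\<forall>j<N. q j \<le> z j \<and> z j \<le> q j + 1" for z
      proof -
        have "real (z i) \<le> real (q i) + 1" "real (q i) \<le> real (z i)" using that True by auto
        then show "real (z i) / real p \<le> real (q i) / real p + 1 / real p" "real (q i) / real p \<le> real (z i) / real p"
          using p(1) by (auto simp: divide_right_mono simp flip: add_divide_distrib)
      qed
      show ?thesis
        using le[OF x(2)] le[OF y(2)] p(2) True unfolding x(1) y(1) pt_def by (simp add: min_def) linarith
    next
      case False
      then show ?thesis using x y \<epsilon>(1) by (simp add: pt_def)
    qed
  qed
  moreover have "T \<subseteq> Hilbert_cube" using pt by (auto simp: T_def)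
  ultimately obtain U where U: "U \<in> \<O>'" "T \<subseteq> U" using \<delta>(2) by blast
  define n where "n = c U"
  define v where "v = Hilbert_cube \<inter> U"
  have n: "n < N" "v \<in> \<V> n" "T \<subseteq> v" using c N U \<open>T \<subseteq> Hilbert_cube\<close> by (auto simp: n_def v_def)
  obtain r s where rs: "\<forall>j<N. q j \<le> r j \<and> r j \<le> q j + 1" "\<forall>j<N. q j \<le> s j \<and> s j \<le> q j + 1" "label r n \<noteq> label s n"
    using q(2) n(1) by blast
  have rv: "pt r \<in> v" "pt s \<in> v" using rs n(3) unfolding T_def by blast+
  show False
  proof (cases "v \<subseteq> lo n")
    case True
    then have "pt r \<in> A n" "pt s \<in> A n" using rv n(2) by (auto simp: A_def)
    then show False using rs(3) by (simp add: label_def)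
  next
    case False
    then have "pt r \<in> B n" "pt s \<in> B n" using rv n(2) by (auto simp: B_def)
    \<comment> \<open>Otherwise \<open>z\<close> would lie in two different members of the disjoint
      family \<open>\<V> n\<close>, one inside \<open>lo n\<close> and one not.\<close>
    moreover have "z \<notin> A n" if "z \<in> v" for z
    proof
      assume "z \<in> A n"
      then obtain v' where v': "v' \<in> \<V> n" "z \<in> v'" "v' \<subseteq> lo n" by (auto simp: A_def)
      then have "v = v'"
        using V(1)[of n] n(2) that unfolding disjoint_refinement_def pairwise_def disjnt_def by blast
      then show False using v' False by blast
    qed
    ultimately show False using rs(3) rv by (simp add: label_def)
  qed
qed

section \<open>Spaces controlled by finite sets\<close>

text \<open>\<open>F m n\<close> is the set of points controlled at level \<open>m\<close> by some
  \<open>n\<close>-tuple, and it is shown to be C by induction on \<open>n\<close>. After the sets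
  \<open>F m k\<close> with \<open>k < n\<close> are removed, a closed remainder \<open>Y\<close> is
  a finite-to-one image of the part \<open>S\<close> of \<open>E m n\<close> above it, and
  \<open>S\<close> is C by its fibration over the \<open>n\<close>-th power of
  \<open>K\<close>.\<close>

lemma C_subset_finite_control:
  fixes H :: "'t topology" and K :: "'a topology" and ctl :: "nat \<Rightarrow> 't \<Rightarrow> 'a set \<Rightarrow> bool"
  assumes H: "compact_space H" "metrizable_space H"
    and K: "compact_space K" "metrizable_space K" "C_subset K (topspace K)"
    and ex: "\<And>t. t \<in> topspace H \<Longrightarrow> \<exists>m A. finite A \<and> A \<subseteq> topspace K \<and> ctl m t A"
    and clo: "\<And>m n. closedin (prod_topology H (product_topology (\<lambda>_. K) {..<n::nat}))
        {(t,x). t \<in> topspace H \<and> x \<in> {..<n} \<rightarrow>\<^sub>E topspace K \<and> ctl m t (x ` {..<n})}"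
    and fin: "\<And>m n t \<A>. \<lbrakk>t \<in> topspace H; infinite \<A>;
        \<And>A. A \<in> \<A> \<Longrightarrow> finite A \<and> A \<subseteq> topspace K \<and> card A \<le> n \<and> ctl m t A\<rbrakk> \<Longrightarrow>
        \<exists>R. finite R \<and> R \<subseteq> topspace K \<and> card R < n \<and> ctl m t R"
    and fib: "\<And>m A. \<lbrakk>finite A; A \<subseteq> topspace K\<rbrakk> \<Longrightarrow> C_subset H {t \<in> topspace H. ctl m t A}"
  shows "C_subset H (topspace H)"
proof -
  define P where "P = (\<lambda>n. product_topology (\<lambda>_::nat. K) {..<n})"
  define X where "X = (\<lambda>n. prod_topology H (P n))"
  \<comment> \<open>Controlling sets are represented by tuples, repetitions allowed, so that they
    are points of a compact metrizable power of \<open>K\<close>.\<close>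
  define E where "E = (\<lambda>m n. {(t,x). t \<in> topspace H \<and> x \<in> {..<n} \<rightarrow>\<^sub>E topspace K \<and> ctl m t (x ` {..<n::nat})})"
  define F where "F = (\<lambda>m n. fst ` E m n)"
  have KH: "Hausdorff_space K" "Hausdorff_space H" using K H metrizable_imp_Hausdorff_space by auto
  have Pc: "compact_space (P n)" and Pm: "metrizable_space (P n)" and PH: "Hausdorff_space (P n)"
    and Pt: "topspace (P n) = {..<n} \<rightarrow>\<^sub>E topspace K" for n
    using K KH unfolding P_def
    by (auto simp: compact_space_product_topology metrizable_space_product_topology
        Hausdorff_space_product_topology)
  have Xc: "compact_space (X n)" and Xm: "metrizable_space (X n)" and Xt: "topspace (X n) = topspace H \<times> topspace (P n)" for n
    using H Pc Pm unfolding X_def by (auto simp: compact_space_prod_topology metrizable_space_prod_topology)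
  have fstc: "continuous_map (X n) H fst" and sndc: "continuous_map (X n) (P n) snd" for n
    unfolding X_def by (auto simp: continuous_map_fst continuous_map_snd)
  have Ec: "closedin (X n) (E m n)" for m n
    using clo[of n m] by (simp add: X_def P_def E_def)
  have fstcl: "closed_map (X n) H fst" for n
    using continuous_imp_closed_map[OF fstc Xc KH(2)] .
  have Fc: "closedin H (F m n)" for m n
    using fstcl Ec unfolding F_def closed_map_def by blast
  have FI: "t \<in> F m (card A)" if A: "t \<in> topspace H" "finite A" "A \<subseteq> topspace K" "ctl m t A" for t m A
  proof -
    obtain b where b: "bij_betw b {..<card A} A"
      using ex_bij_betw_nat_finite[OF A(2)] by (auto simp: atLeast0LessThan)
    define x where "x = restrict b {..<card A}"
    have "x ` {..<card A} = A" using b by (auto simp: x_def bij_betw_def)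
    moreover have "x \<in> {..<card A} \<rightarrow>\<^sub>E topspace K"
      using b A(3) by (auto simp: x_def bij_betw_def)
    ultimately have "(t,x) \<in> E m (card A)" using A by (simp add: E_def)
    then show ?thesis unfolding F_def by force
  qed
  have "C_subset H (F m n)" for m n
  proof (induction n rule: less_induct)
    case (less n)
    show ?case
    proof (rule C_subset_if_complement)
      have "C_subset H (F m k \<inter> F m n)" if "k < n" for k
        by (rule C_subset_closed_subset[OF less(1)[OF that]]) (use Fc closedin_subset in blast)+
      then show "C_subset H (\<Union>((\<lambda>k. F m k \<inter> F m n) ` {..<n}))"
        by (intro C_subset_Union) auto
    next
      fix Y assume Y: "closedin H Y" "Y \<subseteq> F m n" "Y \<inter> \<Union>((\<lambda>k. F m k \<inter> F m n) ` {..<n}) = {}"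
      define S where "S = E m n \<inter> {p \<in> topspace (X n). fst p \<in> Y}"
      have S: "closedin (X n) S"
        unfolding S_def using Ec closedin_continuous_map_preimage[OF fstc Y(1)] by blast
      have SD: "fst p \<in> Y" "fst p \<in> topspace H" "snd p \<in> {..<n} \<rightarrow>\<^sub>E topspace K" "ctl m (fst p) (snd p ` {..<n})"
        if "p \<in> S" for p
        using that by (simp_all add: S_def E_def case_prod_beta)
      have "C_subset (X n) S"
      \<comment> \<open>Fixing all coordinates of the tuple leaves a closed part of a copy of the
        set of \<open>t\<close> controlled by one finite set.\<close>
      proof (rule C_subset_finitely_many_maps[where Y = K and n = n and f = "\<lambda>i p. snd p i"])
        show "continuous_map (X n) K (\<lambda>p. snd p i)" if "i < n" for i
          using continuous_map_compose[OF sndc[of n], of K "\<lambda>x. x i"] continuous_map_product_projection[of i "{..<n}" "\<lambda>_. K"] that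
          by (simp add: P_def o_def)
        fix y assume y: "\<And>i. i < n \<Longrightarrow> y i \<in> topspace K"
        define z where "z = restrict y {..<n}"
        have zP: "z \<in> topspace (P n)" using y by (auto simp: z_def Pt)
        define Q where "Q = {t \<in> topspace H. ctl m t (y ` {..<n})}"
        have inj: "continuous_map H (X n) (\<lambda>t. (t,z))"
          unfolding X_def using zP by (intro continuous_map_pairedI) auto
        have "Q = {t \<in> topspace H. (t,z) \<in> E m n}"
          using zP by (auto simp: Q_def E_def Pt z_def)
        then have "closedin H Q" using closedin_continuous_map_preimage[OF inj Ec] by simp
        moreover have "C_subset H Q"
          unfolding Q_def by (rule fib) (use y in auto)
        moreover have "closed_map H (X n) (\<lambda>t. (t,z))"
          using continuous_imp_closed_map[OF inj H(1)] Xm metrizable_imp_Hausdorff_space by blast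
        ultimately have C: "C_subset (X n) ((\<lambda>t. (t,z)) ` Q)"
          using C_subset_closed_inj_image[OF _ inj _ _ _ Xm] by (meson inj_onI prod.inject)
        show "C_subset (X n) {p \<in> S. \<forall>i<n. snd p i = y i}"
        proof (rule C_subset_closed_subset[OF C])
          have eq: "(\<forall>i<n. snd p i = y i) \<longleftrightarrow> snd p = z" if "p \<in> S" for p
          proof -
            have "snd p \<in> extensional {..<n}" using SD(3)[OF that] by (simp add: PiE_def)
            then have "(\<forall>i\<in>{..<n}. snd p i = z i) \<longrightarrow> snd p = z"
              unfolding z_def using extensionalityI[of "snd p" "{..<n}" "restrict y {..<n}"] by blast
            then show ?thesis by (auto simp: z_def)
          qed
          have "{p \<in> S. \<forall>i<n. snd p i = y i} = S \<inter> {p \<in> topspace (X n). snd p \<in> {z}}"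
            using eq S closedin_subset by blast
          moreover have "closedin (X n) {p \<in> topspace (X n). snd p \<in> {z}}"
            by (rule closedin_continuous_map_preimage[OF sndc]) (use zP PH in \<open>auto simp: closedin_Hausdorff_singleton\<close>)
          ultimately show "closedin (X n) {p \<in> S. \<forall>i<n. snd p i = y i}" using S by auto
          show "{p \<in> S. \<forall>i<n. snd p i = y i} \<subseteq> (\<lambda>t. (t,z)) ` Q"
          proof
            fix p assume p: "p \<in> {p \<in> S. \<forall>i<n. snd p i = y i}"
            then have *: "p \<in> S" "\<forall>i<n. snd p i = y i" by auto
            then have "snd p = z" using eq by blast
            moreover have "snd p ` {..<n} = y ` {..<n}" using *(2) by auto
            then have "fst p \<in> Q" using SD(2,4)[OF *(1)] by (simp add: Q_def)
            ultimately show "p \<in> (\<lambda>t. (t,z)) ` Q" by (metis image_eqI prod.collapse)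
          qed
          show "(\<lambda>t. (t,z)) ` Q \<subseteq> topspace (X n)" using zP by (auto simp: Xt Q_def)
        qed
      qed (use S K KH Xc in auto)
      moreover have "finite {p \<in> S. fst p = t}" for t
      proof (cases "t \<in> Y")
        case True
        define \<X> where "\<X> = {x. (t,x) \<in> S}"
        have tH: "t \<in> topspace H" using True Y(1) closedin_subset by blast
        have X: "x \<in> {..<n} \<rightarrow>\<^sub>E topspace K" "ctl m t (x ` {..<n})" if "x \<in> \<X>" for x
          using SD[of "(t,x)"] that by (auto simp: \<X>_def)
        \<comment> \<open>Infinitely many controlling ranges would yield a controlling set of fewer
          than \<open>n\<close> points, putting \<open>t\<close> into some \<open>F m k\<close> with
          \<open>k < n\<close>, which \<open>Y\<close> avoids.\<close>
        have "finite ((\<lambda>x. x ` {..<n}) ` \<X>)"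
        proof (rule ccontr)
          assume inf: "infinite ((\<lambda>x. x ` {..<n}) ` \<X>)"
          have "\<exists>R. finite R \<and> R \<subseteq> topspace K \<and> card R < n \<and> ctl m t R"
          proof (rule fin[OF tH inf])
            fix A assume "A \<in> (\<lambda>x. x ` {..<n}) ` \<X>"
            then obtain x where x: "x \<in> \<X>" "A = x ` {..<n}" by blast
            then show "finite A \<and> A \<subseteq> topspace K \<and> card A \<le> n \<and> ctl m t A"
              using X[OF x(1)] card_image_le[of "{..<n}" x] by (auto simp: PiE_iff)
          qed
          then obtain R where "finite R" "R \<subseteq> topspace K" "card R < n" "ctl m t R" by blast
          then have "t \<in> F m (card R)" "card R < n" using FI tH by auto
          then show False using Y(2,3) True by blast
        qed
        \<comment> \<open>Each range is finite, so it is the range of only finitely many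
          tuples.\<close>
        then have "finite (\<Union>A\<in>(\<lambda>x. x ` {..<n}) ` \<X>. {..<n} \<rightarrow>\<^sub>E A)"
          by (intro finite_UN_I finite_PiE) auto
        moreover have "\<X> \<subseteq> (\<Union>A\<in>(\<lambda>x. x ` {..<n}) ` \<X>. {..<n} \<rightarrow>\<^sub>E A)"
          using X(1) by (auto simp: PiE_def)
        ultimately have "finite \<X>" using finite_subset by blast
        moreover have "{p \<in> S. fst p = t} \<subseteq> (\<lambda>x. (t,x)) ` \<X>" by (auto simp: \<X>_def)
        ultimately show ?thesis using finite_subset by blast
      next
        case False
        then have "{p \<in> S. fst p = t} = {}" by (auto simp: S_def)
        then show ?thesis by (simp only: finite.emptyI)
      qed
      ultimately have "C_subset H (fst ` S)"
        using C_subset_finite_to_one_image[OF fstc Xc Xm H S] by blast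
      moreover have "fst ` S = Y"
        using Y(2) closedin_subset[of "X n" "E m n"] Ec[of n m] unfolding S_def F_def by force
      ultimately show "C_subset H Y" by simp
    qed (use Fc in auto)
  qed
  then have "C_subset H (\<Union>m. \<Union>n. F m n)"
    by (intro C_subset_UN)
  moreover have "(\<Union>m. \<Union>n. F m n) = topspace H"
  proof
    show "(\<Union>m. \<Union>n. F m n) \<subseteq> topspace H" using Fc closedin_subset by blast
    show "topspace H \<subseteq> (\<Union>m. \<Union>n. F m n)"
    proof
      fix t assume t: "t \<in> topspace H"
      then obtain m A where "finite A" "A \<subseteq> topspace K" "ctl m t A" using ex by blast
      then have "t \<in> F m (card A)" using FI t by simp
      then show "t \<in> (\<Union>m. \<Union>n. F m n)" by blast
    qed
  qed
  ultimately show ?thesis by simp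
qed

text \<open>The set \<open>R\<close> is maximal among the sets contained in infinitely many members of \<open>\<A>\<close>.\<close>

lemma infinite_family_root:
  assumes "infinite \<A>" "\<And>A. A \<in> \<A> \<Longrightarrow> finite A \<and> card A \<le> n"
  obtains R where "finite R" "card R < n" "\<exists>A\<in>\<A>. R \<subseteq> A"
    "\<And>S. finite S \<Longrightarrow> \<exists>A\<in>\<A>. A \<inter> S \<subseteq> R"
proof -
  define \<P> where "\<P> = (\<lambda>R. infinite {A \<in> \<A>. R \<subseteq> A})"
  have P: "finite R \<and> card R < n \<and> (\<exists>A\<in>\<A>. R \<subseteq> A)" if "\<P> R" for R
  proof -
    have "infinite {A \<in> \<A>. R \<subseteq> A}" using that by (simp add: \<P>_def)
    then have "infinite ({A \<in> \<A>. R \<subseteq> A} - {R})" by simp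
    then obtain A where A: "A \<in> \<A>" "R \<subseteq> A" "A \<noteq> R"
      by (metis (mono_tags, lifting) Diff_iff finite.emptyI insertCI mem_Collect_eq ex_in_conv)
    then have "finite A" "card A \<le> n" using assms(2) by auto
    have "card R < card A" using A \<open>finite A\<close> by (intro psubset_card_mono) auto
    then show ?thesis using A \<open>finite A\<close> \<open>card A \<le> n\<close> finite_subset by auto
  qed
  have "\<P> {}" using assms(1) by (simp add: \<P>_def)
  then obtain R where R: "\<P> R" "\<And>R'. \<P> R' \<Longrightarrow> card R' \<le> card R"
    using ex_has_greatest_nat[of \<P> "{}" card n] P by (metis less_imp_le)
  show thesis
  proof (rule that[of R])
    fix S :: "'a set" assume S: "finite S"
    \<comment> \<open>By maximality of \<open>R\<close>, only finitely many members contain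
      \<open>R\<close> and a further point of \<open>S\<close>. Removing them leaves a member that
      meets \<open>S\<close> only inside \<open>R\<close>.\<close>
    have "finite {A \<in> \<A>. insert s R \<subseteq> A}" if "s \<in> S - R" for s
    proof (rule ccontr)
      assume "infinite {A \<in> \<A>. insert s R \<subseteq> A}"
      then have "card (insert s R) \<le> card R" using R(2) by (simp add: \<P>_def)
      then show False using that P[OF R(1)] by simp
    qed
    then have "finite (\<Union>s\<in>S - R. {A \<in> \<A>. insert s R \<subseteq> A})" using S by blast
    then have "infinite ({A \<in> \<A>. R \<subseteq> A} - (\<Union>s\<in>S - R. {A \<in> \<A>. insert s R \<subseteq> A}))"
      using R(1) by (simp add: \<P>_def Diff_infinite_finite)
    then obtain A where "A \<in> {A \<in> \<A>. R \<subseteq> A} - (\<Union>s\<in>S - R. {A \<in> \<A>. insert s R \<subseteq> A})"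
      using infinite_imp_nonempty by blast
    then have "A \<in> \<A>" "A \<inter> S \<subseteq> R" by auto
    then show "\<exists>A\<in>\<A>. A \<inter> S \<subseteq> R" ..
  qed (use P[OF R(1)] in auto)
qed

section \<open>Function spaces and functionals\<close>

lemma contfuns_restrict:
  "continuous_map K euclideanreal f \<Longrightarrow> restrict f (topspace K) \<in> contfuns K"
  unfolding contfuns_def by (auto intro: continuous_map_eq)

lemma contfuns_continuous_map:
  "f \<in> contfuns K \<Longrightarrow> continuous_map K euclideanreal f"
  by (simp add: contfuns_def)

lemma contfuns_scale:
  "f \<in> contfuns K \<Longrightarrow> restrict (\<lambda>x. c * f x) (topspace K) \<in> contfuns K"
  by (intro contfuns_restrict continuous_map_real_mult_left contfuns_continuous_map)

lemma contfuns_bounded: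
  assumes "compact_space K" "f \<in> contfuns K"
  obtains B where "\<And>x. x \<in> topspace K \<Longrightarrow> \<bar>f x\<bar> \<le> B"
proof -
  have "compactin euclideanreal (f ` topspace K)"
    using assms image_compactin contfuns_continuous_map compact_space_def by metis
  then have "bounded (f ` topspace K)" by (simp add: compact_imp_bounded)
  then obtain B where "\<forall>y\<in>f ` topspace K. norm y \<le> B" unfolding bounded_iff by blast
  then show thesis using that by auto
qed

lemma linear_functional_add_scale:
  assumes "linear_functional_on_C K \<phi>" "f \<in> contfuns K" "g \<in> contfuns K"
  shows "\<phi> (restrict (\<lambda>x. f x + c * g x) (topspace K)) = \<phi> f + c * \<phi> g"
proof -
  define G where "G = restrict (\<lambda>x. c * g x) (topspace K)"
  have "restrict (\<lambda>x. f x + c * g x) (topspace K) = restrict (\<lambda>x. f x + G x) (topspace K)"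
    by (auto simp: G_def restrict_def)
  moreover have "\<phi> (restrict (\<lambda>x. f x + G x) (topspace K)) = \<phi> f + \<phi> G" "\<phi> G = c * \<phi> g"
    using assms contfuns_scale[OF assms(3), of c] unfolding linear_functional_on_C_def G_def by blast+
  ultimately show ?thesis by simp
qed

lemma contfuns_add_scale:
  "\<lbrakk>f \<in> contfuns K; g \<in> contfuns K\<rbrakk> \<Longrightarrow> restrict (\<lambda>x. f x + c * g x) (topspace K) \<in> contfuns K"
  by (intro contfuns_restrict continuous_map_add continuous_map_real_mult_left contfuns_continuous_map)

lemma linear_functional_diff:
  "\<lbrakk>linear_functional_on_C K \<phi>; linear_functional_on_C K \<psi>\<rbrakk> \<Longrightarrow>
   linear_functional_on_C K (\<lambda>f. \<phi> f - \<psi> f)"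
  unfolding linear_functional_on_C_def by (simp add: algebra_simps)

text \<open>A Lipschitz map for the supremum distance is norm-continuous. The bound is phrased with
  an arbitrary \<open>D\<close> so that applications need not mention \<open>mdist\<close>.\<close>

lemma dual_C_intro:
  assumes K: "compact_space K" and lin: "linear_functional_on_C K \<phi>"
    and bd: "\<And>f g D. \<lbrakk>f \<in> contfuns K; g \<in> contfuns K; 0 \<le> D; \<And>x. x \<in> topspace K \<Longrightarrow> \<bar>f x - g x\<bar> \<le> D\<rbrakk>
      \<Longrightarrow> \<bar>\<phi> f - \<phi> g\<bar> \<le> B * D"
  shows "\<phi> \<in> dual_C K"
proof -
  let ?m = "cfunspace K euclidean_metric"
  have "mdist euclidean_metric (\<phi> f) (\<phi> g) \<le> B * mdist ?m f g" if f: "f \<in> mspace ?m" and g: "g \<in> mspace ?m" for f g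
  proof -
    have "\<bar>\<phi> f - \<phi> g\<bar> \<le> B * mdist ?m f g"
    proof (rule bd)
      show "f \<in> contfuns K" "g \<in> contfuns K" using f g mspace_cfunspace_compact[OF K] by auto
      show "\<bar>f x - g x\<bar> \<le> mdist ?m f g" if "x \<in> topspace K" for x
        using mdist_cfunspace_imp_mdist_le[OF f g order_refl that] by (simp add: dist_real_def)
    qed simp
    then show ?thesis by (simp add: dist_real_def)
  qed
  then have "Lipschitz_continuous_map ?m euclidean_metric \<phi>"
    unfolding Lipschitz_continuous_map_def by auto
  then have "continuous_map (sup_norm_topology K) euclideanreal \<phi>"
    unfolding sup_norm_topology_def using Lipschitz_continuous_imp_continuous_map by fastforce
  with lin show ?thesis by (simp add: dual_C_def)
qed

lemma dual_C_evaluation: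
  assumes "compact_space K" "x \<in> topspace K"
  shows "(\<lambda>f. f x) \<in> dual_C K"
  by (rule dual_C_intro[OF assms(1), where B = 1]) (use assms(2) in \<open>auto simp: linear_functional_on_C_def\<close>)

lemma continuous_map_C_p_evaluation:
  assumes "x \<in> topspace K"
  shows "continuous_map (C_p K) euclideanreal (\<lambda>f. f x)"
  unfolding C_p_def
  by (intro continuous_map_from_subtopology continuous_map_product_projection assms)

section \<open>Neighbourhoods in the pointwise and weak topologies\<close>

text \<open>The topology \<open>T\<close> is left arbitrary so that the lemma applies to both
  \<open>C_p\<close> and \<open>C_w\<close>.\<close>

lemma openin_finitely_many_evaluations:
  assumes "finite A" "topspace T = contfuns K"
    and "\<And>x. x \<in> A \<Longrightarrow> continuous_map T euclideanreal (\<lambda>f. f x)"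
  shows "openin T {f \<in> contfuns K. \<forall>x\<in>A. \<bar>f x - a x\<bar> < \<epsilon>}"
  using assms(1,3)
proof (induction A)
  case empty
  then show ?case using openin_topspace[of T] assms(2) by simp
next
  case (insert x A)
  have "openin T {f \<in> topspace T. f x \<in> {a x - \<epsilon><..<a x + \<epsilon>}}"
    by (rule openin_continuous_map_preimage[of _ euclideanreal]) (use insert in auto)
  then have "openin T ({f \<in> topspace T. f x \<in> {a x - \<epsilon><..<a x + \<epsilon>}} \<inter>
      {f \<in> contfuns K. \<forall>x\<in>A. \<bar>f x - a x\<bar> < \<epsilon>})"
    using insert by blast
  moreover have "{f \<in> topspace T. f x \<in> {a x - \<epsilon><..<a x + \<epsilon>}} \<inter> {f \<in> contfuns K. \<forall>x\<in>A. \<bar>f x - a x\<bar> < \<epsilon>}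
      = {f \<in> contfuns K. \<forall>x\<in>insert x A. \<bar>f x - a x\<bar> < \<epsilon>}"
    using assms(2) by (auto simp: abs_less_iff)
  ultimately show ?case by simp
qed

lemma C_p_neighbourhood:
  assumes "openin (C_p K) W" "f \<in> W"
  obtains S \<epsilon> where "finite S" "S \<subseteq> topspace K" "0 < \<epsilon>"
    "\<And>g. \<lbrakk>g \<in> contfuns K; \<And>x. x \<in> S \<Longrightarrow> \<bar>g x - f x\<bar> < \<epsilon>\<rbrakk> \<Longrightarrow> g \<in> W"
proof -
  obtain V where V: "openin (powertop_real (topspace K)) V" "W = V \<inter> contfuns K"
    using assms(1) unfolding C_p_def openin_subtopology by blast
  then have "f \<in> V" using assms(2) by blast
  with V(1) have "\<exists>U. finite {i \<in> topspace K. U i \<noteq> UNIV} \<and> (\<forall>i\<in>topspace K. open (U i)) \<and>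
      f \<in> PiE (topspace K) U \<and> PiE (topspace K) U \<subseteq> V"
    unfolding openin_product_topology_alt by simp
  then obtain U where U: "finite {i \<in> topspace K. U i \<noteq> UNIV}" "\<And>i. i \<in> topspace K \<Longrightarrow> open (U i)"
      "f \<in> PiE (topspace K) U" "PiE (topspace K) U \<subseteq> V"
    by blast
  define S where "S = {i \<in> topspace K. U i \<noteq> UNIV}"
  have "\<exists>e>0. \<forall>r. \<bar>r - f i\<bar> < e \<longrightarrow> r \<in> U i" if "i \<in> S" for i
    using U(2)[of i] U(3) that unfolding open_dist S_def by (auto simp: dist_real_def PiE_iff)
  then obtain e where e: "\<And>i. i \<in> S \<Longrightarrow> 0 < e i \<and> (\<forall>r. \<bar>r - f i\<bar> < e i \<longrightarrow> r \<in> U i)"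
    by metis
  \<comment> \<open>The inserted 1 keeps \<open>Min\<close> meaningful when \<open>S\<close> is
    empty.\<close>
  define \<epsilon> where "\<epsilon> = Min (insert 1 (e ` S))"
  have S: "finite S" using U(1) by (simp add: S_def)
  show thesis
  proof (rule that[of S \<epsilon>])
    show "0 < \<epsilon>" unfolding \<epsilon>_def using S e by auto
    fix g assume g: "g \<in> contfuns K" "\<And>x. x \<in> S \<Longrightarrow> \<bar>g x - f x\<bar> < \<epsilon>"
    have "g i \<in> U i" if "i \<in> topspace K" for i
    proof (cases "i \<in> S")
      case True
      have "\<epsilon> \<le> e i" unfolding \<epsilon>_def using S True by auto
      then show ?thesis using g(2)[OF True] e[OF True] by auto
    next
      case False
      then show ?thesis using that by (auto simp: S_def)
    qed
    then have "g \<in> PiE (topspace K) U" using g(1) by (auto simp: contfuns_def PiE_iff)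
    then show "g \<in> W" using U(4) V(2) g(1) by blast
  qed (use S in \<open>auto simp: S_def\<close>)
qed

text \<open>Induction on the generation of the topology from its subbase; intersections take the
  union of the functionals and the smaller radius.\<close>

lemma C_w_neighbourhood:
  assumes "openin (C_w L) W" "g \<in> W"
  obtains \<Psi> \<epsilon> where "finite \<Psi>" "\<Psi> \<subseteq> dual_C L" "0 < \<epsilon>"
    "\<And>g'. \<lbrakk>g' \<in> contfuns L; \<And>\<phi>. \<phi> \<in> \<Psi> \<Longrightarrow> \<bar>\<phi> g' - \<phi> g\<bar> < \<epsilon>\<rbrakk> \<Longrightarrow> g' \<in> W"
proof -
  have "generate_topology_on {{f \<in> contfuns L. \<phi> f \<in> U} | \<phi> U. \<phi> \<in> dual_C L \<and> open U} W"
    using assms(1) unfolding C_w_def by (rule openin_topology_generated_by)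
  then have "\<exists>\<Psi> \<epsilon>. finite \<Psi> \<and> \<Psi> \<subseteq> dual_C L \<and> 0 < \<epsilon> \<and>
      (\<forall>g'\<in>contfuns L. (\<forall>\<phi>\<in>\<Psi>. \<bar>\<phi> g' - \<phi> g\<bar> < \<epsilon>) \<longrightarrow> g' \<in> W)" (is "\<exists>\<Psi> \<epsilon>. ?P \<Psi> \<epsilon>")
    using assms(2)
  proof induction
    case (Int a b)
    then obtain \<Psi> \<epsilon> \<Psi>' \<epsilon>' where 1: "finite \<Psi>" "\<Psi> \<subseteq> dual_C L" "0 < \<epsilon>"
        "\<forall>g'\<in>contfuns L. (\<forall>\<phi>\<in>\<Psi>. \<bar>\<phi> g' - \<phi> g\<bar> < \<epsilon>) \<longrightarrow> g' \<in> a"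
      and 2: "finite \<Psi>'" "\<Psi>' \<subseteq> dual_C L" "0 < \<epsilon>'"
        "\<forall>g'\<in>contfuns L. (\<forall>\<phi>\<in>\<Psi>'. \<bar>\<phi> g' - \<phi> g\<bar> < \<epsilon>') \<longrightarrow> g' \<in> b"
      by auto
    show ?case
    proof (intro exI conjI ballI impI)
      show "finite (\<Psi> \<union> \<Psi>')" "\<Psi> \<union> \<Psi>' \<subseteq> dual_C L" "0 < min \<epsilon> \<epsilon>'" using 1 2 by auto
      fix g' assume "g' \<in> contfuns L" "\<forall>\<phi>\<in>\<Psi> \<union> \<Psi>'. \<bar>\<phi> g' - \<phi> g\<bar> < min \<epsilon> \<epsilon>'"
      then show "g' \<in> a \<inter> b" using 1(4) 2(4) by auto
    qed
  next
    case (UN \<K>)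
    then obtain k where "k \<in> \<K>" "g \<in> k" by blast
    with UN(2)[of k] show ?case by blast
  next
    case (Basis s)
    then obtain \<phi> U where s: "s = {f \<in> contfuns L. \<phi> f \<in> U}" "\<phi> \<in> dual_C L" "open U" by blast
    then obtain e where "e > 0" "\<forall>r. dist r (\<phi> g) < e \<longrightarrow> r \<in> U"
      using Basis(2) unfolding open_dist by blast
    then show ?case using s by (intro exI[of _ "{\<phi>}"] exI[of _ e]) (auto simp: dist_real_def)
  qed auto
  then obtain \<Psi> \<epsilon> where P: "?P \<Psi> \<epsilon>" by blast
  show thesis
    by (rule that[of \<Psi> \<epsilon>]) (use P in blast)+
qed

text \<open>Urysohn's lemma, finite sets being closed in a Hausdorff space.\<close>

lemma contfuns_separating:
  assumes K: "compact_space K" "Hausdorff_space K"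
    and A: "finite A" "A \<subseteq> topspace K" and B: "finite B" "B \<subseteq> topspace K" and AB: "A \<inter> B = {}"
  obtains h where "h \<in> contfuns K" "\<And>x. x \<in> A \<Longrightarrow> h x = 1" "\<And>x. x \<in> B \<Longrightarrow> h x = 0"
    "\<And>x. x \<in> topspace K \<Longrightarrow> 0 \<le> h x \<and> h x \<le> 1"
proof -
  have n: "normal_space K" using K compact_Hausdorff_or_regular_imp_normal_space by blast
  have c: "closedin K A" "closedin K B"
    using A B K(2) by (auto intro: closedin_Hausdorff_finite)
  obtain f where f: "continuous_map K (top_of_set {0..1}) f" "f ` B \<subseteq> {0::real}" "f ` A \<subseteq> {1}"
    using Urysohn_lemma[OF n c(2,1), of 0 1] AB by (auto simp: disjnt_def Int_commute)
  show thesis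
  proof (rule that[of "restrict f (topspace K)"])
    show "restrict f (topspace K) \<in> contfuns K"
      using f(1) continuous_map_in_subtopology by (intro contfuns_restrict) blast
    have "f \<in> topspace K \<rightarrow> {0..1}" using f(1) by (simp add: continuous_map_in_subtopology)
    then show "0 \<le> restrict f (topspace K) x \<and> restrict f (topspace K) x \<le> 1" if "x \<in> topspace K" for x
      using that by auto
  qed (use f A B in auto)
qed

text \<open>Functionals vanishing on the common kernel of \<Psi> are combinations of members of
  \<Psi>, so they form a finite-dimensional space and finitely many test functions detect them. In
  the induction, \<psi> either vanishes on the common kernel of the others or contributes one test
  function \<open>e\<close> from it.\<close>

lemma linear_functionals_finitely_determined:
  assumes "finite \<Psi>" "\<And>\<phi>. \<phi> \<in> \<Psi> \<Longrightarrow> linear_functional_on_C L \<phi>"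
  shows "\<exists>G. finite G \<and> G \<subseteq> contfuns L \<and>
    (\<forall>l. linear_functional_on_C L l \<longrightarrow>
       (\<forall>g\<in>contfuns L. (\<forall>\<phi>\<in>\<Psi>. \<phi> g = 0) \<longrightarrow> l g = 0) \<longrightarrow> (\<forall>g\<in>G. l g = 0) \<longrightarrow>
       (\<forall>g\<in>contfuns L. l g = 0))"
  using assms
proof (induction \<Psi>)
  case empty
  then show ?case by (intro exI[of _ "{}"]) auto
next
  case (insert \<psi> \<Psi>)
  then obtain G where G: "finite G" "G \<subseteq> contfuns L"
    "\<And>l. \<lbrakk>linear_functional_on_C L l; \<forall>g\<in>contfuns L. (\<forall>\<phi>\<in>\<Psi>. \<phi> g = 0) \<longrightarrow> l g = 0; \<forall>g\<in>G. l g = 0\<rbrakk>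
        \<Longrightarrow> \<forall>g\<in>contfuns L. l g = 0"
    by (metis insertI2)
  show ?case
  proof (cases "\<exists>g\<in>contfuns L. (\<forall>\<phi>\<in>\<Psi>. \<phi> g = 0) \<and> \<psi> g \<noteq> 0")
    case True
    then obtain e where e: "e \<in> contfuns L" "\<forall>\<phi>\<in>\<Psi>. \<phi> e = 0" "\<psi> e \<noteq> 0" by blast
    show ?thesis
    proof (intro exI conjI allI impI)
      show "finite (insert e G)" "insert e G \<subseteq> contfuns L" using G e by auto
      fix l assume l: "linear_functional_on_C L l"
        "\<forall>g\<in>contfuns L. (\<forall>\<phi>\<in>insert \<psi> \<Psi>. \<phi> g = 0) \<longrightarrow> l g = 0" "\<forall>g\<in>insert e G. l g = 0"
      have "l g = 0" if g: "g \<in> contfuns L" "\<forall>\<phi>\<in>\<Psi>. \<phi> g = 0" for g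
      proof -
        \<comment> \<open>The multiple of \<open>e\<close> is chosen so that \<psi> vanishes on the
          corrected function \<open>d\<close>.\<close>
        define c where "c = - (\<psi> g / \<psi> e)"
        define d where "d = restrict (\<lambda>x. g x + c * e x) (topspace L)"
        have *: "\<phi> d = \<phi> g + c * \<phi> e" if "linear_functional_on_C L \<phi>" for \<phi>
          unfolding d_def by (rule linear_functional_add_scale[OF that g(1) e(1)])
        have "\<psi> d = 0" using *[of \<psi>] insert.prems e(3) by (simp add: c_def)
        moreover have "\<phi> d = 0" if "\<phi> \<in> \<Psi>" for \<phi>
          using *[OF insert.prems[of \<phi>]] bspec[OF g(2) that] bspec[OF e(2) that] that by simp
        ultimately have "\<forall>\<phi>\<in>insert \<psi> \<Psi>. \<phi> d = 0" by simp
        moreover have "d \<in> contfuns L" unfolding d_def by (rule contfuns_add_scale[OF g(1) e(1)])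
        ultimately have "l d = 0" using l(2) by blast
        then show ?thesis using *[OF l(1)] l(3) by simp
      qed
      then show "\<forall>g\<in>contfuns L. l g = 0" using G(3)[OF l(1)] l(3) by blast
    qed
  next
    case False
    show ?thesis
    proof (intro exI conjI allI impI)
      fix l assume l: "linear_functional_on_C L l"
        "\<forall>g\<in>contfuns L. (\<forall>\<phi>\<in>insert \<psi> \<Psi>. \<phi> g = 0) \<longrightarrow> l g = 0" "\<forall>g\<in>G. l g = 0"
      have "\<forall>g\<in>contfuns L. (\<forall>\<phi>\<in>\<Psi>. \<phi> g = 0) \<longrightarrow> l g = 0"
        using False l(2) by blast
      then show "\<forall>g\<in>contfuns L. l g = 0" using G(3)[OF l(1)] l(3) by blast
    qed (use G in auto)
  qed
qed

section \<open>Weighted sums of point evaluations\<close>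

text \<open>Integration against the atomic measure with mass \<open>(1/2)^i * t i\<close> at
  \<open>y i\<close>; the weights make the total mass finite for bounded \<open>t\<close>.\<close>

definition weighted_eval :: "(nat \<Rightarrow> 'b) \<Rightarrow> (nat \<Rightarrow> real) \<Rightarrow> ('b \<Rightarrow> real) \<Rightarrow> real" where
  "weighted_eval y t g = (\<Sum>i. (1/2)^i * (t i * g (y i)))"

lemma geometric_weight_bound:
  assumes "\<bar>r\<bar> \<le> 1" "\<bar>a\<bar> \<le> B"
  shows "norm ((1/2)^i * (r * a)) \<le> B * (1/2::real)^i"
proof -
  have "\<bar>r\<bar> * \<bar>a\<bar> \<le> 1 * B" using assms by (intro mult_mono) auto
  then show ?thesis by (simp add: abs_mult mult_left_mono mult.commute)
qed

lemma summable_weighted_eval: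
  assumes "\<And>i. \<bar>t i\<bar> \<le> 1" "\<And>i. \<bar>a i\<bar> \<le> B"
  shows "summable (\<lambda>i. (1/2)^i * (t i * a i :: real))"
  by (rule summable_comparison_test'[of "\<lambda>i. B * (1/2)^i"])
    (use geometric_weight_bound assms in \<open>auto intro: summable_mult summable_geometric\<close>)

text \<open>The functional is Lipschitz with constant 2, the sum of the weights.\<close>

lemma weighted_eval_dual:
  assumes L: "compact_space L" and y: "\<And>i. y i \<in> topspace L" and t: "\<And>i. \<bar>t i\<bar> \<le> 1"
  shows "weighted_eval y t \<in> dual_C L"
proof (rule dual_C_intro[OF L])
  have sm: "summable (\<lambda>i. (1/2)^i * (t i * f (y i)))" if f: "f \<in> contfuns L" for f
  proof -
    obtain B where "\<And>x. x \<in> topspace L \<Longrightarrow> \<bar>f x\<bar> \<le> B" using contfuns_bounded[OF L f] by blast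
    then show ?thesis using y by (intro summable_weighted_eval[OF t, where B = B]) auto
  qed
  show "linear_functional_on_C L (weighted_eval y t)"
    unfolding linear_functional_on_C_def
  proof (intro conjI ballI allI)
    fix f g assume "f \<in> contfuns L" "g \<in> contfuns L"
    then show "weighted_eval y t (restrict (\<lambda>x. f x + g x) (topspace L)) = weighted_eval y t f + weighted_eval y t g"
      unfolding weighted_eval_def using suminf_add[OF sm[of f] sm[of g]] y by (simp add: algebra_simps)
  next
    fix c f assume "f \<in> contfuns L"
    then show "weighted_eval y t (restrict (\<lambda>x. c * f x) (topspace L)) = c * weighted_eval y t f"
      unfolding weighted_eval_def using suminf_mult[OF sm[of f], of c] y by (simp add: algebra_simps)
  qed
  fix f g D assume fg: "f \<in> contfuns L" "g \<in> contfuns L" "0 \<le> D" "\<And>x. x \<in> topspace L \<Longrightarrow> \<bar>f x - g x\<bar> \<le> D"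
  have "weighted_eval y t f - weighted_eval y t g = (\<Sum>i. (1/2)^i * (t i * (f (y i) - g (y i))))"
    unfolding weighted_eval_def using suminf_diff[OF sm[OF fg(1)] sm[OF fg(2)]] by (simp add: algebra_simps)
  moreover have "norm (\<Sum>i. (1/2)^i * (t i * (f (y i) - g (y i)))) \<le> (\<Sum>i. D * (1/2)^i)"
  proof (rule norm_suminf_le)
    show "norm ((1/2)^i * (t i * (f (y i) - g (y i)))) \<le> D * (1/2)^i" for i
      by (rule geometric_weight_bound[OF t fg(4)[OF y]])
  qed (intro summable_mult summable_geometric, simp)
  moreover have "(\<Sum>i. D * (1/2::real)^i) = 2 * D"
    by (simp add: suminf_mult suminf_geometric)
  ultimately show "\<bar>weighted_eval y t f - weighted_eval y t g\<bar> \<le> 2 * D" by simp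
qed

text \<open>A test function with value 1 at \<open>y k\<close> and 0 at the other \<open>y i\<close>
  with \<open>i \<le> N\<close> isolates the \<open>k\<close>-th term up to a tail. The bound on
  \<open>t\<close> is the one that differences of two points of the Hilbert cube satisfy.\<close>

lemma weighted_eval_injective:
  assumes L: "compact_space L" "Hausdorff_space L"
    and y: "\<And>i. y i \<in> topspace L" "inj y" and t: "\<And>i. \<bar>t i\<bar> \<le> 1"
    and zero: "\<And>g. g \<in> contfuns L \<Longrightarrow> weighted_eval y t g = 0"
  shows "t k = 0"
proof (rule ccontr)
  assume "t k \<noteq> 0"
  then have "0 < \<bar>t k\<bar> * (1/2)^k" by simp
  then obtain N0 where N0: "(1/2::real)^N0 < \<bar>t k\<bar> * (1/2)^k"
    using real_arch_pow_inv[of _ "1/2"] by fastforce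
  \<comment> \<open>Besides making the tail bound \<open>(1/2)^N\<close> smaller than the
    \<open>k\<close>-th term, \<open>N\<close> must be at least \<open>k\<close>, so that this term
    lies in the initial segment.\<close>
  define N where "N = max N0 k"
  have "(1/2::real)^N \<le> (1/2)^N0" unfolding N_def by (intro power_decreasing) auto
  then have N: "(1/2::real)^N < \<bar>t k\<bar> * (1/2)^k" using N0 by linarith
  have kN: "k \<le> N" by (simp add: N_def)
  obtain g where g: "g \<in> contfuns L" "g (y k) = 1" "\<And>x. x \<in> y ` ({..N} - {k}) \<Longrightarrow> g x = 0"
      "\<And>x. x \<in> topspace L \<Longrightarrow> 0 \<le> g x \<and> g x \<le> 1"
  proof (rule contfuns_separating[OF L, of "{y k}" "y ` ({..N} - {k})"])
    show "{y k} \<inter> y ` ({..N} - {k}) = {}" using y(2) by (auto simp: inj_def)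
  qed (use y(1) in auto)
  have g1: "\<bar>g (y i)\<bar> \<le> 1" for i using g(4)[OF y(1)[of i]] by auto
  define a where "a = (\<lambda>i. (1/2)^i * (t i * g (y i)))"
  have sm: "summable a" unfolding a_def by (rule summable_weighted_eval[OF t g1])
  have "sum a {..<Suc N} = a k"
  proof -
    have "sum a {..<Suc N} = sum a {k}"
      by (rule sum.mono_neutral_right) (use kN g(3) in \<open>auto simp: a_def\<close>)
    then show ?thesis by simp
  qed
  then have "(\<Sum>i. a (i + Suc N)) + a k = 0"
    using suminf_split_initial_segment[OF sm, of "Suc N"] zero[OF g(1)]
    unfolding a_def weighted_eval_def by simp
  moreover have "norm (\<Sum>i. a (i + Suc N)) \<le> (\<Sum>i. 1 * (1/2)^(i + Suc N))"
  proof (rule norm_suminf_le)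
    show "norm (a (i + Suc N)) \<le> 1 * (1/2)^(i + Suc N)" for i
      unfolding a_def by (rule geometric_weight_bound[OF t g1])
    show "summable (\<lambda>i. 1 * (1/2::real)^(i + Suc N))"
      using summable_ignore_initial_segment[OF summable_geometric[of "1/2::real"], of "Suc N"] by simp
  qed
  moreover have "(\<Sum>i. 1 * (1/2::real)^(i + Suc N)) = (1/2)^N"
  proof -
    have "(\<lambda>i. (1/2)^Suc N * (1/2::real)^i) sums ((1/2)^Suc N * (1 / (1 - 1/2)))"
      by (intro sums_mult geometric_sums) simp
    moreover have "(\<lambda>i. (1/2)^Suc N * (1/2::real)^i) = (\<lambda>i. 1 * (1/2)^(i + Suc N))"
      by (simp add: power_add mult.commute)
    ultimately have "(\<lambda>i. 1 * (1/2::real)^(i + Suc N)) sums ((1/2)^Suc N * (1 / (1 - 1/2)))"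
      by simp
    from sums_unique[OF this] show ?thesis by simp
  qed
  ultimately have "\<bar>a k\<bar> \<le> (1/2)^N" by simp
  then show False using N g(2) by (simp add: a_def abs_mult mult.commute)
qed

lemma weighted_eval_diff:
  assumes "compact_space L" "\<And>i. y i \<in> topspace L" "\<And>i. \<bar>t i\<bar> \<le> 1" "\<And>i. \<bar>s i\<bar> \<le> 1" "g \<in> contfuns L"
  shows "weighted_eval y (\<lambda>i. t i - s i) g = weighted_eval y t g - weighted_eval y s g"
proof -
  obtain B where B: "\<And>x. x \<in> topspace L \<Longrightarrow> \<bar>g x\<bar> \<le> B" using contfuns_bounded[OF assms(1,5)] by blast
  have sm: "summable (\<lambda>i. (1/2)^i * (r i * g (y i)))" if "\<And>i. \<bar>r i\<bar> \<le> 1" for r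
    using B assms(2) that by (intro summable_weighted_eval[where B = B]) auto
  have "(\<Sum>i. (1/2)^i * (t i * g (y i))) - (\<Sum>i. (1/2)^i * (s i * g (y i)))
      = (\<Sum>i. (1/2)^i * (t i * g (y i)) - (1/2)^i * (s i * g (y i)))"
    by (rule suminf_diff) (intro sm assms)+
  then show ?thesis
    unfolding weighted_eval_def by (simp add: left_diff_distrib right_diff_distrib)
qed

section \<open>Homeomorphisms between function spaces\<close>

text \<open>The scale is \<open>1 / real (Suc m)\<close>, so \<open>m = 0\<close> is meaningful. The
  strict inequality in the premise and the nonstrict one in the conclusion make the condition closed
  in the pair of controlled functional and controlling tuple.\<close>

definition controls :: "'a topology \<Rightarrow> (('a \<Rightarrow> real) \<Rightarrow> 'c) \<Rightarrow> ('c \<Rightarrow> real) \<Rightarrow> nat \<Rightarrow> 'a set \<Rightarrow> bool" where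
  "controls K h \<phi> m A \<longleftrightarrow> (\<forall>f\<in>contfuns K. (\<forall>x\<in>A. \<bar>f x\<bar> < 1 / real (Suc m)) \<longrightarrow>
      \<bar>\<phi> (h f) - \<phi> (h (restrict (\<lambda>x. 0) (topspace K)))\<bar> \<le> 1)"

lemma zero_contfuns: "restrict (\<lambda>x. 0) (topspace K) \<in> contfuns K"
  by (intro contfuns_restrict) simp

lemma continuous_map_dual_compose:
  assumes "continuous_map (C_p K) (C_w L) h" "\<phi> \<in> dual_C L"
  shows "continuous_map (C_p K) euclideanreal (\<lambda>f. \<phi> (h f))"
  using continuous_map_compose[OF assms(1) continuous_map_C_w_dual[OF assms(2)]] by (simp add: o_def)

text \<open>Continuity of \<open>\<phi> \<circ> h\<close> at the zero function provides a basic
  pointwise neighbourhood on which it varies by less than 1.\<close>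

lemma exists_controls:
  assumes h: "continuous_map (C_p K) (C_w L) h" and \<phi>: "\<phi> \<in> dual_C L"
  shows "\<exists>m A. finite A \<and> A \<subseteq> topspace K \<and> controls K h \<phi> m A"
proof -
  let ?z = "restrict (\<lambda>x. 0::real) (topspace K)"
  define W where "W = {f \<in> topspace (C_p K). \<phi> (h f) \<in> ball (\<phi> (h ?z)) 1}"
  have "openin (C_p K) W"
    unfolding W_def by (rule openin_continuous_map_preimage[OF continuous_map_dual_compose[OF h \<phi>]]) auto
  moreover have "?z \<in> W" using zero_contfuns by (simp add: W_def)
  ultimately obtain S \<epsilon> where S: "finite S" "S \<subseteq> topspace K" "0 < \<epsilon>"
    "\<And>g. \<lbrakk>g \<in> contfuns K; \<And>x. x \<in> S \<Longrightarrow> \<bar>g x - ?z x\<bar> < \<epsilon>\<rbrakk> \<Longrightarrow> g \<in> W"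
    by (rule C_p_neighbourhood) blast
  obtain m where m: "1 / real (Suc m) < \<epsilon>" using S(3) nat_approx_posE by blast
  have "controls K h \<phi> m S"
    unfolding controls_def
  proof (intro ballI impI)
    fix f assume f: "f \<in> contfuns K" "\<forall>x\<in>S. \<bar>f x\<bar> < 1 / real (Suc m)"
    have "f \<in> W"
    proof (rule S(4)[OF f(1)])
      fix x assume "x \<in> S"
      then have "\<bar>f x\<bar> < \<epsilon>" "?z x = 0" using f(2) m S(2) by force+
      then show "\<bar>f x - ?z x\<bar> < \<epsilon>" by simp
    qed
    then show "\<bar>\<phi> (h f) - \<phi> (h ?z)\<bar> \<le> 1" by (simp add: W_def dist_real_def abs_minus_commute)
  qed
  then show ?thesis using S by blast
qed

text \<open>If the root \<open>R\<close> fails to control, then some \<open>f\<close> that is small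
  on \<open>R\<close> violates the bound, and so do all functions close to \<open>f\<close> on a
  finite set \<open>S\<close>. Some member of \<A> meets \<open>S\<close> only inside
  \<open>R\<close>, so \<open>f\<close> can be changed off \<open>S\<close> to be small on that
  member, which contradicts its control.\<close>

lemma controls_root:
  assumes K: "compact_space K" "Hausdorff_space K"
    and h: "continuous_map (C_p K) (C_w L) h" and \<phi>: "\<phi> \<in> dual_C L"
    and inf: "infinite \<A>"
    and A: "\<And>A. A \<in> \<A> \<Longrightarrow> finite A \<and> A \<subseteq> topspace K \<and> card A \<le> n \<and> controls K h \<phi> m A"
  shows "\<exists>R. finite R \<and> R \<subseteq> topspace K \<and> card R < n \<and> controls K h \<phi> m R"
proof -
  let ?z = "restrict (\<lambda>x. 0::real) (topspace K)"
  obtain R where R: "finite R" "card R < n" "\<exists>A\<in>\<A>. R \<subseteq> A"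
    "\<And>S. finite S \<Longrightarrow> \<exists>A\<in>\<A>. A \<inter> S \<subseteq> R"
    using infinite_family_root[OF inf, of n] A by metis
  have "controls K h \<phi> m R"
    unfolding controls_def
  proof (intro ballI impI, rule ccontr)
    fix f assume f: "f \<in> contfuns K" "\<forall>x\<in>R. \<bar>f x\<bar> < 1 / real (Suc m)"
      and neg: "\<not> \<bar>\<phi> (h f) - \<phi> (h ?z)\<bar> \<le> 1"
    \<comment> \<open>Violating the nonstrict bound is an open condition on
      \<open>f\<close>.\<close>
    define W where "W = {f \<in> topspace (C_p K). \<phi> (h f) \<in> - cball (\<phi> (h ?z)) 1}"
    have "openin (C_p K) W"
      unfolding W_def by (rule openin_continuous_map_preimage[OF continuous_map_dual_compose[OF h \<phi>]]) auto
    moreover have "f \<in> W" using f(1) neg by (simp add: W_def dist_real_def abs_minus_commute)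
    ultimately obtain S \<epsilon> where S: "finite S" "S \<subseteq> topspace K" "0 < \<epsilon>"
      "\<And>g. \<lbrakk>g \<in> contfuns K; \<And>x. x \<in> S \<Longrightarrow> \<bar>g x - f x\<bar> < \<epsilon>\<rbrakk> \<Longrightarrow> g \<in> W"
      by (rule C_p_neighbourhood) blast
    obtain B where B: "B \<in> \<A>" "B \<inter> S \<subseteq> R" using R(4)[OF S(1)] by blast
    have B': "finite B" "B \<subseteq> topspace K" "controls K h \<phi> m B" using A[OF B(1)] by auto
    \<comment> \<open>\<open>g\<close> agrees with \<open>f\<close> on \<open>S\<close> and is small on \<open>B\<close>, because \<open>B \<inter> S \<subseteq> R\<close>.\<close>
    obtain e where e: "e \<in> contfuns K" "\<And>x. x \<in> S \<Longrightarrow> e x = 1" "\<And>x. x \<in> B - S \<Longrightarrow> e x = 0"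
      using contfuns_separating[OF K S(1,2), of "B - S"] B' by (metis Diff_disjoint Diff_subset finite_Diff subset_trans)
    define g where "g = restrict (\<lambda>x. f x * e x) (topspace K)"
    have g: "g \<in> contfuns K"
      unfolding g_def using f(1) e(1)
      by (intro contfuns_restrict continuous_map_real_mult contfuns_continuous_map)
    have "g x = f x" if "x \<in> S" for x using that S(2) e(2) by (auto simp: g_def)
    then have "g \<in> W" using S(3) by (intro S(4)[OF g]) auto
    moreover have "\<bar>g x\<bar> < 1 / real (Suc m)" if "x \<in> B" for x
    proof (cases "x \<in> S")
      case True
      then show ?thesis using \<open>x \<in> S \<Longrightarrow> g x = f x\<close> B(2) f(2) that by auto
    next
      case False
      then show ?thesis using e(3)[of x] that B'(2) by (auto simp: g_def)
    qed
    then have "\<bar>\<phi> (h g) - \<phi> (h ?z)\<bar> \<le> 1" using B'(3) g unfolding controls_def by blast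
    ultimately show False by (simp add: W_def dist_real_def abs_minus_commute)
  qed
  moreover have "R \<subseteq> topspace K" using R(3) A by blast
  ultimately show ?thesis using R(1,2) by blast
qed

text \<open>The image under \<open>h\<close> of the functions small on \<open>A\<close> is weakly
  open, hence contains a neighbourhood given by a finite \<Psi>. A controlled functional is bounded
  on it and therefore vanishes on the common kernel of \<Psi>, so finitely many test functions tell
  such functionals apart.\<close>

lemma controls_finitely_determined:
  assumes h: "homeomorphic_map (C_p K) (C_w L) h" and A: "finite A" "A \<subseteq> topspace K"
  obtains G where "finite G" "G \<subseteq> contfuns L"
    "\<And>\<phi> \<psi>. \<lbrakk>\<phi> \<in> dual_C L; \<psi> \<in> dual_C L; controls K h \<phi> m A; controls K h \<psi> m A;
        \<And>g. g \<in> G \<Longrightarrow> \<phi> g = \<psi> g\<rbrakk> \<Longrightarrow> \<forall>g\<in>contfuns L. \<phi> g = \<psi> g"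
proof -
  let ?z = "restrict (\<lambda>x. 0::real) (topspace K)"
  define U where "U = {f \<in> contfuns K. \<forall>x\<in>A. \<bar>f x\<bar> < 1 / real (Suc m)}"
  have "openin (C_p K) U"
  proof -
    have "continuous_map (C_p K) euclideanreal (\<lambda>f. f x)" if "x \<in> A" for x
      by (rule continuous_map_C_p_evaluation) (use A(2) that in blast)
    from openin_finitely_many_evaluations[OF A(1) topspace_C_p this, where a = "\<lambda>_. 0" and \<epsilon> = "1 / real (Suc m)"]
    show ?thesis unfolding U_def by simp
  qed
  then have "openin (C_w L) (h ` U)"
    using h homeomorphic_imp_open_map open_map_def by metis
  moreover have "?z \<in> U" using A(2) zero_contfuns[of K] by (auto simp: U_def)
  then have "h ?z \<in> h ` U" by blast
  ultimately obtain \<Psi> \<epsilon> where \<Psi>: "finite \<Psi>" "\<Psi> \<subseteq> dual_C L" "0 < \<epsilon>"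
    "\<And>g'. \<lbrakk>g' \<in> contfuns L; \<And>\<phi>. \<phi> \<in> \<Psi> \<Longrightarrow> \<bar>\<phi> g' - \<phi> (h ?z)\<bar> < \<epsilon>\<rbrakk> \<Longrightarrow> g' \<in> h ` U"
    by (rule C_w_neighbourhood) blast
  have hz: "h ?z \<in> contfuns L"
    using homeomorphic_imp_surjective_map[OF h] zero_contfuns[of K] by auto
  have lin: "linear_functional_on_C L \<phi>" if "\<phi> \<in> dual_C L" for \<phi>
    using that by (simp add: dual_C_def)
  \<comment> \<open>The line \<open>h(0) + s g\<close> stays in \<open>h ` U\<close>, on which \<open>\<phi>\<close> is bounded.\<close>
  have kill: "\<phi> g = 0" if \<phi>: "\<phi> \<in> dual_C L" "controls K h \<phi> m A"
    and g: "g \<in> contfuns L" "\<forall>\<psi>\<in>\<Psi>. \<psi> g = 0" for \<phi> g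
  proof (rule ccontr)
    assume nz: "\<phi> g \<noteq> 0"
    \<comment> \<open>This step changes the value of \<phi> by exactly 2, beyond the permitted
      1.\<close>
    define s where "s = 2 / \<phi> g"
    define g' where "g' = restrict (\<lambda>x. h ?z x + s * g x) (topspace L)"
    have lg: "\<psi> g' = \<psi> (h ?z) + s * \<psi> g" if "\<psi> \<in> dual_C L" for \<psi>
      unfolding g'_def by (rule linear_functional_add_scale[OF lin[OF that] hz g(1)])
    have "g' \<in> contfuns L" unfolding g'_def by (rule contfuns_add_scale[OF hz g(1)])
    moreover have "\<bar>\<psi> g' - \<psi> (h ?z)\<bar> < \<epsilon>" if "\<psi> \<in> \<Psi>" for \<psi>
    proof -
      have "\<psi> \<in> dual_C L" using that \<Psi>(2) by blast
      then show ?thesis using lg[of \<psi>] bspec[OF g(2) that] \<Psi>(3) by simp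
    qed
    ultimately have "g' \<in> h ` U" by (rule \<Psi>(4))
    then obtain f where f: "f \<in> U" "g' = h f" by blast
    then have "\<bar>\<phi> g' - \<phi> (h ?z)\<bar> \<le> 1" using \<phi>(2) unfolding controls_def U_def by blast
    then show False using lg[OF \<phi>(1)] nz by (simp add: s_def)
  qed
  obtain G where G: "finite G" "G \<subseteq> contfuns L"
    "\<And>l. \<lbrakk>linear_functional_on_C L l; \<forall>g\<in>contfuns L. (\<forall>\<phi>\<in>\<Psi>. \<phi> g = 0) \<longrightarrow> l g = 0; \<forall>g\<in>G. l g = 0\<rbrakk>
        \<Longrightarrow> \<forall>g\<in>contfuns L. l g = 0"
  proof (rule exE[OF linear_functionals_finitely_determined[OF \<Psi>(1), of L]])
    show "linear_functional_on_C L \<phi>" if "\<phi> \<in> \<Psi>" for \<phi> using lin \<Psi>(2) that by blast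
  qed (elim conjE, rule that, assumption, assumption, blast)
  show thesis
  proof (rule that[OF G(1,2)])
    fix \<phi> \<psi> assume p: "\<phi> \<in> dual_C L" "\<psi> \<in> dual_C L" "controls K h \<phi> m A" "controls K h \<psi> m A"
      "\<And>g. g \<in> G \<Longrightarrow> \<phi> g = \<psi> g"
    have "\<forall>g\<in>contfuns L. \<phi> g - \<psi> g = 0"
    proof (rule G(3))
      show "linear_functional_on_C L (\<lambda>g. \<phi> g - \<psi> g)"
        by (rule linear_functional_diff) (use lin p in auto)
      show "\<forall>g\<in>contfuns L. (\<forall>\<phi>\<in>\<Psi>. \<phi> g = 0) \<longrightarrow> \<phi> g - \<psi> g = 0"
        using kill[OF p(1,3)] kill[OF p(2,4)] by simp
    qed (use p in auto)
    then show "\<forall>g\<in>contfuns L. \<phi> g = \<psi> g" by simp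
  qed
qed

lemma continuous_map_weighted_eval:
  assumes L: "compact_space L" and y: "\<And>i. y i \<in> topspace L" and g: "g \<in> contfuns L"
  shows "continuous_map (top_of_set Hilbert_cube) euclideanreal (\<lambda>t. weighted_eval y t g)"
proof -
  obtain B where B: "\<And>x. x \<in> topspace L \<Longrightarrow> \<bar>g x\<bar> \<le> B" using contfuns_bounded[OF L g] by blast
  have "uniform_limit Hilbert_cube (\<lambda>n t. \<Sum>i<n. (1/2)^i * (t i * g (y i)))
      (\<lambda>t. \<Sum>i. (1/2)^i * (t i * g (y i))) sequentially"
  proof (rule Weierstrass_m_test)
    show "norm ((1/2)^i * (t i * g (y i))) \<le> B * (1/2)^i" if "t \<in> Hilbert_cube" for i t
      by (rule geometric_weight_bound) (use that B[OF y] in \<open>auto simp: Hilbert_cube_def abs_le_iff intro: order_trans[of _ 0]\<close>)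
    show "summable (\<lambda>i. B * (1/2::real)^i)" by (intro summable_mult summable_geometric) simp
  qed
  moreover have "continuous_on Hilbert_cube (\<lambda>t. \<Sum>i<n. (1/2)^i * (t i * g (y i)))" for n
    by (intro continuous_intros continuous_on_subset[OF continuous_on_product_coordinates]) auto
  ultimately have "continuous_on Hilbert_cube (\<lambda>t. \<Sum>i. (1/2)^i * (t i * g (y i)))"
    by (intro uniform_limit_theorem[rotated]) auto
  then show ?thesis by (simp add: weighted_eval_def)
qed

section \<open>The case of infinite \<open>L\<close>\<close>

lemma no_homeomorphism_infinite:
  assumes K: "compact_space K" "metrizable_space K" "C_space K"
    and L: "compact_space L" "Hausdorff_space L" "infinite (topspace L)"
    and h: "homeomorphic_map (C_p K) (C_w L) h"
  shows False
proof -
  let ?H = "top_of_set Hilbert_cube"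
  let ?z = "restrict (\<lambda>x. 0::real) (topspace K)"
  obtain y :: "nat \<Rightarrow> 'b" where y: "inj y" "range y \<subseteq> topspace L"
    using infinite_countable_subset[OF L(3)] by blast
  have yL: "y i \<in> topspace L" for i using y(2) by blast
  define \<phi> where "\<phi> = weighted_eval y"
  have bd: "\<bar>t i\<bar> \<le> 1" if "t \<in> Hilbert_cube" for t i
    using that by (auto simp: Hilbert_cube_def abs_le_iff intro: order_trans[of _ 0])
  have \<phi>: "\<phi> t \<in> dual_C L" if "t \<in> Hilbert_cube" for t
    unfolding \<phi>_def by (rule weighted_eval_dual[OF L(1) yL bd[OF that]])
  have \<phi>c: "continuous_map ?H euclideanreal (\<lambda>t. \<phi> t g)" if "g \<in> contfuns L" for g
    unfolding \<phi>_def by (rule continuous_map_weighted_eval[OF L(1) yL that])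
  have hc: "continuous_map (C_p K) (C_w L) h"
    using h homeomorphic_imp_continuous_map by blast
  have hL: "h f \<in> contfuns L" if "f \<in> contfuns K" for f
    using homeomorphic_imp_surjective_map[OF h] that by auto
  have KH: "Hausdorff_space K" using K metrizable_imp_Hausdorff_space by blast
  have diff: "continuous_map ?H euclideanreal (\<lambda>t. \<phi> t (h f) - \<phi> t (h ?z))" if "f \<in> contfuns K" for f
    by (intro continuous_map_diff \<phi>c hL that zero_contfuns)
  have "C_subset ?H (topspace ?H)"
  proof (rule C_subset_finite_control[where ctl = "\<lambda>m t A. controls K h (\<phi> t) m A" and K = K])
    show "compact_space ?H"
      using compact_Hilbert_cube by (simp add: compact_space_subtopology)
    show "metrizable_space ?H"
      by (intro metrizable_space_subtopology metrizable_space_euclidean)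
    show "C_subset K (topspace K)" using K C_space_imp_C_subset by blast
    show "\<exists>m A. finite A \<and> A \<subseteq> topspace K \<and> controls K h (\<phi> t) m A" if "t \<in> topspace ?H" for t
      using exists_controls[OF hc \<phi>] that by auto
    show "\<exists>R. finite R \<and> R \<subseteq> topspace K \<and> card R < n \<and> controls K h (\<phi> t) m R"
      if "t \<in> topspace ?H" "infinite \<A>"
        "\<And>A. A \<in> \<A> \<Longrightarrow> finite A \<and> A \<subseteq> topspace K \<and> card A \<le> n \<and> controls K h (\<phi> t) m A" for m n t \<A>
      by (rule controls_root[OF K(1) KH hc \<phi> that(2,3)]) (use that(1) in auto)
  next
    fix m n
    let ?X = "prod_topology ?H (product_topology (\<lambda>_. K) {..<n::nat})"
    \<comment> \<open>The implication in \<open>controls\<close> for a single \<open>f\<close>,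
      written as a union of closed sets: \<open>f\<close> is not small at some \<open>x i\<close>,
      or the functional varies by at most 1. Intersecting over all \<open>f\<close> gives the full
      condition.\<close>
    define E where "E = (\<lambda>f. (\<Union>i\<in>{..<n}. {p \<in> topspace ?X. f (snd p i) \<in> - {- 1 / real (Suc m)<..<1 / real (Suc m)}})
        \<union> {p \<in> topspace ?X. \<phi> (fst p) (h f) - \<phi> (fst p) (h ?z) \<in> {-1..1}})"
    have "closedin ?X (E f)" if f: "f \<in> contfuns K" for f
    proof -
      have c: "continuous_map ?X euclideanreal (\<lambda>p. f (snd p i))" if "i < n" for i
      proof -
        have "continuous_map ?X K (\<lambda>p. snd p i)"
          using continuous_map_compose[OF continuous_map_snd[of ?H "product_topology (\<lambda>_. K) {..<n}"]
              continuous_map_product_projection[of i "{..<n}" "\<lambda>_. K"]] that by (simp add: o_def)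
        from continuous_map_compose[OF this contfuns_continuous_map[OF f]] show ?thesis
          by (simp add: o_def)
      qed
      have d: "continuous_map ?X euclideanreal (\<lambda>p. \<phi> (fst p) (h f) - \<phi> (fst p) (h ?z))"
        using continuous_map_compose[OF continuous_map_fst[of ?H "product_topology (\<lambda>_. K) {..<n}"] diff[OF f]]
        by (simp add: o_def)
      have "closedin ?X {p \<in> topspace ?X. f (snd p i) \<in> - {- 1 / real (Suc m)<..<1 / real (Suc m)}}"
        if "i < n" for i
        by (rule closedin_continuous_map_preimage[OF c[OF that]])
          (simp only: flip: closed_closedin, simp add: closed_Compl)
      then have "closedin ?X (\<Union>i\<in>{..<n}. {p \<in> topspace ?X. f (snd p i) \<in> - {- 1 / real (Suc m)<..<1 / real (Suc m)}})"
        by (intro closedin_Union) auto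
      moreover have "closedin ?X {p \<in> topspace ?X. \<phi> (fst p) (h f) - \<phi> (fst p) (h ?z) \<in> {-1..1}}"
        by (rule closedin_continuous_map_preimage[OF d]) simp
      ultimately show ?thesis
        unfolding E_def by (rule closedin_Un)
    qed
    then have "closedin ?X (\<Inter>f\<in>contfuns K. E f)"
      using zero_contfuns[of K] by (intro closedin_Inter) auto
    moreover have "(\<Inter>f\<in>contfuns K. E f) =
      {(t,x). t \<in> topspace ?H \<and> x \<in> {..<n} \<rightarrow>\<^sub>E topspace K \<and> controls K h (\<phi> t) m (x ` {..<n})}"
    proof (rule set_eqI)
      fix p :: "(nat \<Rightarrow> real) \<times> (nat \<Rightarrow> 'a)"
      obtain t x where p: "p = (t,x)" by (cases p)
      have "p \<in> E f \<longleftrightarrow> p \<in> topspace ?X \<and>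
          ((\<forall>i<n. \<bar>f (x i)\<bar> < 1 / real (Suc m)) \<longrightarrow> \<bar>\<phi> t (h f) - \<phi> t (h ?z)\<bar> \<le> 1)" for f
        unfolding E_def p by (auto simp: abs_less_iff abs_le_iff minus_less_iff)
      then show "p \<in> (\<Inter>f\<in>contfuns K. E f) \<longleftrightarrow> p \<in> {(t,x). t \<in> topspace ?H \<and> x \<in> {..<n} \<rightarrow>\<^sub>E topspace K \<and>
          controls K h (\<phi> t) m (x ` {..<n})}"
        using zero_contfuns[of K] unfolding controls_def p by auto
    qed
    ultimately show "closedin ?X {(t,x). t \<in> topspace ?H \<and> x \<in> {..<n} \<rightarrow>\<^sub>E topspace K \<and>
          controls K h (\<phi> t) m (x ` {..<n})}"
      by simp
  next
    fix m A assume A: "finite A" "A \<subseteq> topspace K"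
    let ?S = "{t \<in> topspace ?H. controls K h (\<phi> t) m A}"
    define U where "U = {f \<in> contfuns K. \<forall>x\<in>A. \<bar>f x\<bar> < 1 / real (Suc m)}"
    have zU: "?z \<in> U" using zero_contfuns[of K] A(2) by (auto simp: U_def)
    have "closedin ?H {t \<in> topspace ?H. \<phi> t (h f) - \<phi> t (h ?z) \<in> {-1..1}}" if "f \<in> U" for f
      by (rule closedin_continuous_map_preimage[OF diff]) (use that in \<open>auto simp: U_def\<close>)
    then have "closedin ?H (\<Inter>f\<in>U. {t \<in> topspace ?H. \<phi> t (h f) - \<phi> t (h ?z) \<in> {-1..1}})"
      using zU by (intro closedin_Inter) auto
    moreover have "(\<Inter>f\<in>U. {t \<in> topspace ?H. \<phi> t (h f) - \<phi> t (h ?z) \<in> {-1..1}}) = ?S"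
    proof -
      have "r \<in> {-1..1} \<longleftrightarrow> \<bar>r\<bar> \<le> 1" for r :: real by auto
      then show ?thesis using zU unfolding controls_def by (auto simp: U_def)
    qed
    ultimately have clo: "closedin ?H ?S" by simp
    obtain G where G: "finite G" "G \<subseteq> contfuns L"
      "\<And>\<phi> \<psi>. \<lbrakk>\<phi> \<in> dual_C L; \<psi> \<in> dual_C L; controls K h \<phi> m A; controls K h \<psi> m A;
        \<And>g. g \<in> G \<Longrightarrow> \<phi> g = \<psi> g\<rbrakk> \<Longrightarrow> \<forall>g\<in>contfuns L. \<phi> g = \<psi> g"
      by (rule controls_finitely_determined[OF h A, of m]) blast
    obtain b where b: "G = b ` {i. i < card G}"
      using finite_imp_nat_seg_image_inj_on[OF G(1)] by (metis bij_betw_def card_image card_Collect_less_nat)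
    show "C_subset ?H ?S"
    proof (rule C_subset_finitely_many_maps[where f = "\<lambda>i t. \<phi> t (b i)" and n = "card G" and Y = euclideanreal])
      show "continuous_map ?H euclideanreal (\<lambda>t. \<phi> t (b i))" if "i < card G" for i
        by (rule \<phi>c) (use b G(2) that in blast)
      show "compact_space ?H"
        using compact_Hilbert_cube by (simp add: compact_space_subtopology)
      show "C_subset euclideanreal (topspace euclideanreal)" using C_subset_real by simp
      fix r :: "nat \<Rightarrow> real"
      \<comment> \<open>The values on \<open>G\<close> determine a controlled functional, and the
        functional determines its point of the cube; hence each fibre has at most one point.\<close>
      have single: "t = s" if ts: "t \<in> ?S" "s \<in> ?S" "\<forall>i<card G. \<phi> t (b i) = r i" "\<forall>i<card G. \<phi> s (b i) = r i" for t s
      proof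
        fix k
        have T: "t \<in> Hilbert_cube" "s \<in> Hilbert_cube" using ts by auto
        have "\<phi> t g = \<phi> s g" if g: "g \<in> G" for g
        proof -
          obtain i where "i < card G" "g = b i" using g b by blast
          then show ?thesis using ts(3,4) by simp
        qed
        then have eq: "\<forall>g\<in>contfuns L. \<phi> t g = \<phi> s g"
          by (intro G(3) \<phi> T) (use ts in auto)
        have "(\<lambda>i. t i - s i) k = 0"
        proof (rule weighted_eval_injective[OF L(1,2) yL y(1)])
          show "\<bar>t i - s i\<bar> \<le> 1" for i using T by (auto simp: Hilbert_cube_def abs_le_iff) (smt (verit))+
          show "weighted_eval y (\<lambda>i. t i - s i) g = 0" if "g \<in> contfuns L" for g
            using weighted_eval_diff[OF L(1) yL bd[OF T(1)] bd[OF T(2)] that] eq that by (simp add: \<phi>_def)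
        qed
        then show "t k = s k" by simp
      qed
      show "C_subset ?H {t \<in> ?S. \<forall>i<card G. \<phi> t (b i) = r i}"
      proof (cases "{t \<in> ?S. \<forall>i<card G. \<phi> t (b i) = r i} = {}")
        case False
        then obtain s where s: "s \<in> ?S" "\<forall>i<card G. \<phi> s (b i) = r i" by blast
        have "t = s" if "t \<in> ?S" "\<forall>i<card G. \<phi> t (b i) = r i" for t
          by (rule single[OF that(1) s(1) that(2) s(2)])
        then have "{t \<in> ?S. \<forall>i<card G. \<phi> t (b i) = r i} \<subseteq> {s}" by blast
        then show ?thesis by (rule C_subset_singleton)
      qed (simp only: C_subset_empty)
    qed (use clo in auto)
  qed (use K in auto)
  then show False using not_C_subset_Hilbert_cube by simp
qed

section \<open>The case of finite \<open>L\<close>\<close>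

text \<open>For finite \<open>L\<close>, pointwise closeness is uniform closeness, so every
  norm-continuous functional is continuous on \<open>C_p L\<close>, and the weak topology is the
  weakest with this property.\<close>

lemma openin_C_w_imp_openin_C_p_finite:
  assumes L: "compact_space L" "finite (topspace L)" and S: "openin (C_w L) S"
  shows "openin (C_p L) S"
proof (rule C_w_weakest[OF topspace_C_p _ S])
  fix \<phi> assume \<phi>: "\<phi> \<in> dual_C L"
  let ?m = "cfunspace L euclidean_metric"
  have "continuous_map (C_p L) (mtopology_of ?m) id"
    unfolding mtopology_of_def
  proof (rule Metric_space.continuous_map_to_metric[THEN iffD2])
    show "Metric_space (mspace ?m) (mdist ?m)" by (rule Metric_space_mspace_mdist)
    show "\<forall>f\<in>topspace (C_p L). \<forall>\<epsilon>>0. \<exists>U. openin (C_p L) U \<and> f \<in> U \<and>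
        (\<forall>g\<in>U. id g \<in> Metric_space.mball (mspace ?m) (mdist ?m) (id f) \<epsilon>)"
    proof (intro ballI allI impI)
      fix f \<epsilon> assume f: "f \<in> topspace (C_p L)" and \<epsilon>: "(0::real) < \<epsilon>"
      \<comment> \<open>Pointwise bounds only give a nonstrict bound on the supremum distance;
        halving \<epsilon> makes it strict.\<close>
      define U where "U = {g \<in> contfuns L. \<forall>x\<in>topspace L. \<bar>g x - f x\<bar> < \<epsilon>/2}"
      have "openin (C_p L) U"
        unfolding U_def
        by (rule openin_finitely_many_evaluations[OF L(2) topspace_C_p continuous_map_C_p_evaluation])
      moreover have "f \<in> U" using f \<epsilon> by (simp add: U_def)
      moreover have "g \<in> Metric_space.mball (mspace ?m) (mdist ?m) f \<epsilon>" if "g \<in> U" for g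
      proof -
        have "mdist ?m f g \<le> \<epsilon>/2"
          by (rule mdist_cfunspace_le)
            (use \<epsilon> that in \<open>auto simp: U_def dist_real_def abs_minus_commute intro: less_imp_le\<close>)
        then have "mdist ?m f g < \<epsilon>" using \<epsilon> by simp
        moreover have "f \<in> mspace ?m" "g \<in> mspace ?m"
          using f that mspace_cfunspace_compact[OF L(1)] by (auto simp: U_def simp del: mspace_cfunspace)
        ultimately show ?thesis
          by (simp add: Metric_space.in_mball del: mspace_cfunspace)
      qed
      ultimately show "\<exists>U. openin (C_p L) U \<and> f \<in> U \<and>
          (\<forall>g\<in>U. id g \<in> Metric_space.mball (mspace ?m) (mdist ?m) (id f) \<epsilon>)"
        by auto
    qed
  qed
  moreover have "continuous_map (mtopology_of ?m) euclideanreal \<phi>"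
    using \<phi> by (simp add: dual_C_def sup_norm_topology_def)
  ultimately show "continuous_map (C_p L) euclideanreal \<phi>"
    using continuous_map_compose by fastforce
qed

text \<open>A finite Hausdorff space is discrete, so all extensional functions are continuous and
  the set is a product of closed intervals. Compactness passes from the pointwise to the weaker
  topology.\<close>

lemma compactin_C_w_finite:
  assumes L: "compact_space L" "Hausdorff_space L" "finite (topspace L)"
  shows "compactin (C_w L) {g \<in> contfuns L. \<forall>x\<in>topspace L. \<bar>g x - c x\<bar> \<le> 1}"
proof -
  let ?B = "{g \<in> contfuns L. \<forall>x\<in>topspace L. \<bar>g x - c x\<bar> \<le> 1}"
  have "L = discrete_topology (topspace L)"
    using L(2,3) finite_topspace_imp_discrete_topology by (metis)
  then have ext: "contfuns L = extensional (topspace L)"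
    unfolding contfuns_def by (metis (no_types, lifting) Collect_mem_eq continuous_map_from_discrete_topology
        Collect_cong UNIV_I Pi_I topspace_euclidean)
  have "compactin (powertop_real (topspace L)) (PiE (topspace L) (\<lambda>x. cball (c x) 1))"
    by (simp add: compactin_PiE)
  moreover have "PiE (topspace L) (\<lambda>x. cball (c x) 1) = ?B"
    by (auto simp: ext PiE_iff dist_real_def abs_minus_commute extensional_def)
  ultimately have "compactin (C_p L) ?B"
    by (simp add: C_p_def compactin_subtopology)
  then show ?thesis
    using openin_C_w_imp_openin_C_p_finite[OF L(1,3)] unfolding compactin_def by simp
qed

text \<open>A neighbourhood of zero in \<open>C_p K\<close> constrains only finitely many points, so
  it contains a line of functions unbounded at some further point. The homeomorphism would place
  this line in a compact set.\<close>

lemma no_homeomorphism_finite: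
  assumes K: "compact_space K" "Hausdorff_space K" "infinite (topspace K)"
    and L: "compact_space L" "Hausdorff_space L" "finite (topspace L)"
    and hk: "homeomorphic_maps (C_p K) (C_w L) h k"
  shows False
proof -
  let ?z = "restrict (\<lambda>x. 0::real) (topspace K)"
  have h: "continuous_map (C_p K) (C_w L) h" and k: "continuous_map (C_w L) (C_p K) k"
    and kh: "\<And>f. f \<in> contfuns K \<Longrightarrow> k (h f) = f"
    using hk by (auto simp: homeomorphic_maps_def)
  define W where "W = {g \<in> contfuns L. \<forall>x\<in>topspace L. \<bar>g x - h ?z x\<bar> < 1}"
  have "openin (C_w L) W"
    unfolding W_def
    by (rule openin_finitely_many_evaluations[OF L(3) topspace_C_w])
      (intro continuous_map_C_w_dual dual_C_evaluation L)
  then have "openin (C_p K) {f \<in> topspace (C_p K). h f \<in> W}"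
    by (rule openin_continuous_map_preimage[OF h])
  moreover have "h ?z \<in> contfuns L"
    using h zero_contfuns[of K] by (auto simp: continuous_map_def)
  then have "?z \<in> {f \<in> topspace (C_p K). h f \<in> W}"
    using zero_contfuns by (simp add: W_def)
  ultimately obtain S \<epsilon> where S: "finite S" "S \<subseteq> topspace K" "0 < \<epsilon>"
    "\<And>g. \<lbrakk>g \<in> contfuns K; \<And>x. x \<in> S \<Longrightarrow> \<bar>g x - ?z x\<bar> < \<epsilon>\<rbrakk> \<Longrightarrow> g \<in> {f \<in> topspace (C_p K). h f \<in> W}"
    by (rule C_p_neighbourhood) blast
  obtain x where x: "x \<in> topspace K" "x \<notin> S"
    using K(3) S(1) by (metis finite_subset subsetI)
  obtain e where e: "e \<in> contfuns K" "e x = 1" "\<And>x. x \<in> S \<Longrightarrow> e x = 0"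
    by (rule contfuns_separating[OF K(1,2), of "{x}" S]) (use x S in auto)
  define B where "B = {g \<in> contfuns L. \<forall>x\<in>topspace L. \<bar>g x - h ?z x\<bar> \<le> 1}"
  have "compactin (C_w L) B"
    unfolding B_def by (rule compactin_C_w_finite[OF L])
  then have "compactin (C_p K) (k ` B)" using image_compactin k by blast
  then have "compactin euclideanreal ((\<lambda>f. f x) ` (k ` B))"
    using image_compactin continuous_map_C_p_evaluation[OF x(1)] by blast
  then have "bounded ((\<lambda>f. f x) ` (k ` B))" by (simp add: compact_imp_bounded)
  then obtain C where C: "\<And>g. g \<in> B \<Longrightarrow> \<bar>k g x\<bar> \<le> C"
    unfolding bounded_iff by auto
  \<comment> \<open>Every multiple of \<open>e\<close> vanishes on \<open>S\<close>, so
    \<open>h\<close> maps it into \<open>B\<close>, yet its value at \<open>x\<close> is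
    arbitrary.\<close>
  have "\<bar>c\<bar> \<le> C" for c :: real
  proof -
    define f where "f = restrict (\<lambda>u. c * e u) (topspace K)"
    have f: "f \<in> contfuns K" unfolding f_def by (rule contfuns_scale[OF e(1)])
    have "f \<in> {f \<in> topspace (C_p K). h f \<in> W}"
      by (rule S(4)[OF f]) (use S(2,3) e(3) in \<open>auto simp: f_def\<close>)
    then have "h f \<in> B" by (auto simp: W_def B_def intro: less_imp_le)
    then have "\<bar>f x\<bar> \<le> C" using C[of "h f"] kh[OF f] by simp
    then show ?thesis using x(1) e(2) by (simp add: f_def)
  qed
  from this[of "\<bar>C\<bar> + 1"] show False by simp
qed

theorem mainTheorem8:
  fixes K :: "'a topology" and L :: "'b topology"
  assumes "infinite (topspace K)"
    and "compact_space K"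
    and "metrizable_space K"
    and "C_space K"
    and "compact_space L"
    and "Hausdorff_space L"
  shows "\<not> C_p K homeomorphic_space C_w L"
proof
  assume "C_p K homeomorphic_space C_w L"
  then obtain h k where hk: "homeomorphic_maps (C_p K) (C_w L) h k"
    unfolding homeomorphic_space_def by blast
  then have "homeomorphic_map (C_p K) (C_w L) h"
    using homeomorphic_map_maps by blast
  moreover have "Hausdorff_space K"
    using assms(3) metrizable_imp_Hausdorff_space by blast
  \<comment> \<open>The two cases are \<open>topspace L\<close> infinite and
    \<open>topspace L\<close> finite.\<close>
  ultimately show False
    using hk assms no_homeomorphism_infinite no_homeomorphism_finite by metis
qed

end
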